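(* Let $\{\mathcal L^i=(L^i_+,L^i_-;\mathsf{con}^i,\mathsf{tot}^i)\}_{i\in\mathcal I}$ be a family of d-frames and let $\bigoplus_i\mathcal L^i=(\bigoplus_i L^i_+,\bigoplus_i L^i_-;\mathsf{Con}_*,\mathsf{Tot}_* )$ be the structure constructed below. Then $\bigoplus_i\mathcal L^i$ is the coproduct of $\{\mathcal L^i\}_{i\in\mathcal I}$ in the category of d-frames and d-frame homomorphisms (with coproduct injections $\iota^j=(a\mapsto a\oplus_j\mathbf 1,\ b\mapsto b\oplus_j\mathbf 1)\colon\mathcal L^j\to\bigoplus_i\mathcal L^i$).
   Context: For frames $L_+,L_-$, on $L_+\times L_-$ consider the information order $\alpha\sqsubseteq\beta$ iff $\alpha_+\le\beta_+$ and $\alpha_-\le\beta_-$, and the logical operations $\alpha\vee\beta=(\alpha_+\vee\beta_+,\alpha_-\wedge\beta_-)$, $\alpha\wedge\beta=(\alpha_+\wedge\beta_+,\alpha_-\vee\beta_-)$, with $tt=(1,0)$, $ff=(0,1)$. A d-frame is $(L_+,L_-;\mathsf{con},\mathsf{tot})$ with $L_\pm$ frames and $\mathsf{con},\mathsf{tot}\subseteq L_+\times L_-$ such that: $\mathsf{con}$ is $\sqsubseteq$-downward closed; $\mathsf{tot}$ is $\sqsubseteq$-upward closed; $tt,ff\in\mathsf{con}\cap\mathsf{tot}$; $\mathsf{con}$ and $\mathsf{tot}$ are closed under logical $\wedge,\vee$; $\mathsf{con}$ is closed under joins of $\sqsubseteq$-directed subsets (computed coordinatewise); and (con-tot): if $\alpha\in\mathsf{con}$,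 $\beta\in\mathsf{tot}$ and ($\alpha_+=\beta_+$ or $\alpha_-=\beta_-$) then $\alpha\sqsubseteq\beta$. A d-frame homomorphism is a pair $(h_+,h_-)$ of frame homomorphisms with $(h_+(\alpha_+),h_-(\alpha_-))\in\mathsf{con}$ for all $\alpha\in\mathsf{con}$ and likewise for $\mathsf{tot}$. Construction: for $\pm\in\{+,-\}$ let $B_\pm=\prod'_iL^i_\pm$ be the set of elements of $\prod_iL^i_\pm$ with all but finitely many coordinates equal to $1$ (a meet-semilattice under pointwise order), $\mathbf 1$ its top element. For $a\in L^j_\pm$ and $u\in B_\pm$ let $a*_ju\in B_\pm$ have $j$-th coordinate $a$ and $i$-th coordinate $u_i$ for $i\ne j$. Let $\mathcal C_\pm$ consist of all pairs $\{a^k*_ju:k\in K\}\dashv(\bigvee_ka^k)*_ju$ ($j\in\mathcal I$, $\{a^k\}\subseteq L^j_\pm$, $u\in B_\pm$). A $\mathcal C_\pm$-ideal is a downset $I\subseteq B_\pm$ such that whenever $U\dashv a\in\mathcal C_\pm$ and $U\subseteq I$ then $a\in I$. $\bigoplus_iL^i_\pm$ is the frame of all $\mathcal C_\pm$-ideals ordered by inclusion. Put $\mathbf n_\pm=\{u\in B_\pm: u_i=0\text{ for some }i\}$ and $a\oplus_ju=\downarrow(a*_ju)\cup\mathbf n_\pm$ (the smallest $\mathcal C_\pm$-ideal containing $a*_ju$). Let $\mathsf{con}_1=\{(a\oplus_j\mathbf 1,b\oplus_j\mathbf 1):j\in\mathcal I,(a,b)\in\mathsf{con}^j\}$ and $\mathsf{tot}_1$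 analogously with $\mathsf{tot}^j$. $\mathsf{Con}_*$ is the smallest subset of $\bigoplus_iL^i_+\times\bigoplus_iL^i_-$ containing $\mathsf{con}_1$, $tt$, $ff$ that is $\sqsubseteq$-downward closed and closed under logical $\wedge,\vee$ and $\sqsubseteq$-directed joins; $\mathsf{Tot}_*$ is the smallest subset containing $\mathsf{tot}_1$, $tt$, $ff$ that is $\sqsubseteq$-upward closed and closed under logical $\wedge,\vee$. *)

theory Defs
  imports "HOL-Algebra.Complete_Lattice" "HOL-Library.FuncSet"
begin

section \<open>Frames\<close>

locale frame = complete_lattice L for L (structure) +
  assumes meet_sup_distrib:
    "\<lbrakk>a \<in> carrier L; A \<subseteq> carrier L\<rbrakk> \<Longrightarrow> a \<sqinter> (\<Squnion> A) = \<Squnion> ((\<lambda>x. a \<sqinter> x) ` A)"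

text \<open>Morphisms are extensional functions, so that equality of morphisms is equality in HOL.\<close>

definition frame_hom :: "'a gorder \<Rightarrow> 'b gorder \<Rightarrow> ('a \<Rightarrow> 'b) set" where
  "frame_hom L M =
     {h \<in> carrier L \<rightarrow>\<^sub>E carrier M.
        h \<top>\<^bsub>L\<^esub> = \<top>\<^bsub>M\<^esub> \<and>
        (\<forall>x\<in>carrier L. \<forall>y\<in>carrier L. h (x \<sqinter>\<^bsub>L\<^esub> y) = h x \<sqinter>\<^bsub>M\<^esub> h y) \<and>
        (\<forall>A\<subseteq>carrier L. h (\<Squnion>\<^bsub>L\<^esub> A) = \<Squnion>\<^bsub>M\<^esub> (h ` A))}"


section \<open>The product of two frames: information order and logical operations\<close>

definition info_le :: "'a gorder \<Rightarrow> 'b gorder \<Rightarrow> 'a \<times> 'b \<Rightarrow> 'a \<times> 'b \<Rightarrow> bool" where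
  "info_le P N \<alpha> \<beta> \<longleftrightarrow> fst \<alpha> \<sqsubseteq>\<^bsub>P\<^esub> fst \<beta> \<and> snd \<alpha> \<sqsubseteq>\<^bsub>N\<^esub> snd \<beta>"

definition log_or :: "'a gorder \<Rightarrow> 'b gorder \<Rightarrow> 'a \<times> 'b \<Rightarrow> 'a \<times> 'b \<Rightarrow> 'a \<times> 'b" where
  "log_or P N \<alpha> \<beta> = (fst \<alpha> \<squnion>\<^bsub>P\<^esub> fst \<beta>, snd \<alpha> \<sqinter>\<^bsub>N\<^esub> snd \<beta>)"

definition log_and :: "'a gorder \<Rightarrow> 'b gorder \<Rightarrow> 'a \<times> 'b \<Rightarrow> 'a \<times> 'b \<Rightarrow> 'a \<times> 'b" where
  "log_and P N \<alpha> \<beta> = (fst \<alpha> \<sqinter>\<^bsub>P\<^esub> fst \<beta>, snd \<alpha> \<squnion>\<^bsub>N\<^esub> snd \<beta>)"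

definition tt :: "'a gorder \<Rightarrow> 'b gorder \<Rightarrow> 'a \<times> 'b" where
  "tt P N = (\<top>\<^bsub>P\<^esub>, \<bottom>\<^bsub>N\<^esub>)"

definition ff :: "'a gorder \<Rightarrow> 'b gorder \<Rightarrow> 'a \<times> 'b" where
  "ff P N = (\<bottom>\<^bsub>P\<^esub>, \<top>\<^bsub>N\<^esub>)"

definition info_directed :: "'a gorder \<Rightarrow> 'b gorder \<Rightarrow> ('a \<times> 'b) set \<Rightarrow> bool" where
  "info_directed P N D \<longleftrightarrow>
     D \<noteq> {} \<and> (\<forall>\<alpha>\<in>D. \<forall>\<beta>\<in>D. \<exists>\<gamma>\<in>D. info_le P N \<alpha> \<gamma> \<and> info_le P N \<beta> \<gamma>)"

definition info_down_closed :: "'a gorder \<Rightarrow> 'b gorder \<Rightarrow> ('a \<times> 'b) set \<Rightarrow> bool" where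
  "info_down_closed P N X \<longleftrightarrow>
     (\<forall>\<beta>\<in>X. \<forall>\<alpha>\<in>carrier P \<times> carrier N. info_le P N \<alpha> \<beta> \<longrightarrow> \<alpha> \<in> X)"

definition info_up_closed :: "'a gorder \<Rightarrow> 'b gorder \<Rightarrow> ('a \<times> 'b) set \<Rightarrow> bool" where
  "info_up_closed P N X \<longleftrightarrow>
     (\<forall>\<alpha>\<in>X. \<forall>\<beta>\<in>carrier P \<times> carrier N. info_le P N \<alpha> \<beta> \<longrightarrow> \<beta> \<in> X)"

definition log_closed :: "'a gorder \<Rightarrow> 'b gorder \<Rightarrow> ('a \<times> 'b) set \<Rightarrow> bool" where
  "log_closed P N X \<longleftrightarrow>
     (\<forall>\<alpha>\<in>X. \<forall>\<beta>\<in>X. log_and P N \<alpha> \<beta> \<in> X \<and> log_or P N \<alpha> \<beta> \<in> X)"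

definition directed_join_closed :: "'a gorder \<Rightarrow> 'b gorder \<Rightarrow> ('a \<times> 'b) set \<Rightarrow> bool" where
  "directed_join_closed P N X \<longleftrightarrow>
     (\<forall>D\<subseteq>X. info_directed P N D \<longrightarrow> (\<Squnion>\<^bsub>P\<^esub> (fst ` D), \<Squnion>\<^bsub>N\<^esub> (snd ` D)) \<in> X)"


section \<open>D-frames\<close>

record ('a, 'b) dframe =
  pos :: "'a gorder"
  neg :: "'b gorder"
  con :: "('a \<times> 'b) set"
  tot :: "('a \<times> 'b) set"

definition is_dframe :: "('a, 'b) dframe \<Rightarrow> bool" where
  "is_dframe \<L> \<longleftrightarrow>
     frame (pos \<L>) \<and> frame (neg \<L>) \<and>
     con \<L> \<subseteq> carrier (pos \<L>) \<times> carrier (neg \<L>) \<and>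
     tot \<L> \<subseteq> carrier (pos \<L>) \<times> carrier (neg \<L>) \<and>
     info_down_closed (pos \<L>) (neg \<L>) (con \<L>) \<and>
     info_up_closed (pos \<L>) (neg \<L>) (tot \<L>) \<and>
     {tt (pos \<L>) (neg \<L>), ff (pos \<L>) (neg \<L>)} \<subseteq> con \<L> \<inter> tot \<L> \<and>
     log_closed (pos \<L>) (neg \<L>) (con \<L>) \<and>
     log_closed (pos \<L>) (neg \<L>) (tot \<L>) \<and>
     directed_join_closed (pos \<L>) (neg \<L>) (con \<L>) \<and>
     (\<forall>\<alpha>\<in>con \<L>. \<forall>\<beta>\<in>tot \<L>.
        fst \<alpha> = fst \<beta> \<or> snd \<alpha> = snd \<beta> \<longrightarrow> info_le (pos \<L>) (neg \<L>) \<alpha> \<beta>)"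

definition dframe_hom ::
  "('a, 'b) dframe \<Rightarrow> ('c, 'd) dframe \<Rightarrow> (('a \<Rightarrow> 'c) \<times> ('b \<Rightarrow> 'd)) set" where
  "dframe_hom \<L> \<M> =
     {h \<in> frame_hom (pos \<L>) (pos \<M>) \<times> frame_hom (neg \<L>) (neg \<M>).
        (\<forall>\<alpha>\<in>con \<L>. (fst h (fst \<alpha>), snd h (snd \<alpha>)) \<in> con \<M>) \<and>
        (\<forall>\<alpha>\<in>tot \<L>. (fst h (fst \<alpha>), snd h (snd \<alpha>)) \<in> tot \<M>)}"

text \<open>Composition \<open>g \<circ> f\<close> of morphisms with \<open>\<L>\<close> the domain of \<open>f\<close>.\<close>

definition dframe_comp ::
  "('a, 'b) dframe \<Rightarrow> ('c \<Rightarrow> 'e) \<times> ('d \<Rightarrow> 'f) \<Rightarrow> ('a \<Rightarrow> 'c) \<times> ('b \<Rightarrow> 'd)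
     \<Rightarrow> ('a \<Rightarrow> 'e) \<times> ('b \<Rightarrow> 'f)" where
  "dframe_comp \<L> g f =
     (compose (carrier (pos \<L>)) (fst g) (fst f), compose (carrier (neg \<L>)) (snd g) (snd f))"


section \<open>The coproduct of a family of frames\<close>

definition res_prod :: "'i set \<Rightarrow> ('i \<Rightarrow> 'a gorder) \<Rightarrow> ('i \<Rightarrow> 'a) set" where
  "res_prod I L = {u \<in> \<Pi>\<^sub>E i\<in>I. carrier (L i). finite {i \<in> I. u i \<noteq> \<top>\<^bsub>L i\<^esub>}}"

definition res_le :: "'i set \<Rightarrow> ('i \<Rightarrow> 'a gorder) \<Rightarrow> ('i \<Rightarrow> 'a) \<Rightarrow> ('i \<Rightarrow> 'a) \<Rightarrow> bool" where
  "res_le I L u v \<longleftrightarrow> (\<forall>i\<in>I. u i \<sqsubseteq>\<^bsub>L i\<^esub> v i)"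

definition res_top :: "'i set \<Rightarrow> ('i \<Rightarrow> 'a gorder) \<Rightarrow> 'i \<Rightarrow> 'a" where
  "res_top I L = (\<lambda>i\<in>I. \<top>\<^bsub>L i\<^esub>)"

text \<open>The element \<open>a *\<^sub>j u\<close> is \<open>u(j := a)\<close>. A family \<open>{a\<^sup>k : k \<in> K}\<close> enters only through
  its set of values \<open>A\<close>, which may be empty.\<close>

definition coverage :: "'i set \<Rightarrow> ('i \<Rightarrow> 'a gorder) \<Rightarrow> (('i \<Rightarrow> 'a) set \<times> ('i \<Rightarrow> 'a)) set" where
  "coverage I L =
     {((\<lambda>a. u(j := a)) ` A, u(j := \<Squnion>\<^bsub>L j\<^esub> A)) | j A u.
        j \<in> I \<and> A \<subseteq> carrier (L j) \<and> u \<in> res_prod I L}"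

definition C_ideal :: "'i set \<Rightarrow> ('i \<Rightarrow> 'a gorder) \<Rightarrow> ('i \<Rightarrow> 'a) set \<Rightarrow> bool" where
  "C_ideal I L J \<longleftrightarrow>
     J \<subseteq> res_prod I L \<and>
     (\<forall>v\<in>J. \<forall>u\<in>res_prod I L. res_le I L u v \<longrightarrow> u \<in> J) \<and>
     (\<forall>(U, a)\<in>coverage I L. U \<subseteq> J \<longrightarrow> a \<in> J)"

definition frame_coprod :: "'i set \<Rightarrow> ('i \<Rightarrow> 'a gorder) \<Rightarrow> ('i \<Rightarrow> 'a) set gorder" where
  "frame_coprod I L = \<lparr>carrier = {J. C_ideal I L J}, eq = (=), le = (\<subseteq>)\<rparr>"

definition null_ideal :: "'i set \<Rightarrow> ('i \<Rightarrow> 'a gorder) \<Rightarrow> ('i \<Rightarrow> 'a) set" where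
  "null_ideal I L = {u \<in> res_prod I L. \<exists>i\<in>I. u i = \<bottom>\<^bsub>L i\<^esub>}"

definition oplus ::
  "'i set \<Rightarrow> ('i \<Rightarrow> 'a gorder) \<Rightarrow> 'i \<Rightarrow> 'a \<Rightarrow> ('i \<Rightarrow> 'a) \<Rightarrow> ('i \<Rightarrow> 'a) set" where
  "oplus I L j a u = {v \<in> res_prod I L. res_le I L v (u(j := a))} \<union> null_ideal I L"


section \<open>The coproduct of a family of d-frames\<close>

context
  fixes I :: "'i set" and \<L> :: "'i \<Rightarrow> ('a, 'b) dframe"
begin

definition coprod_pos :: "('i \<Rightarrow> 'a) set gorder" where
  "coprod_pos = frame_coprod I (\<lambda>i. pos (\<L> i))"

definition coprod_neg :: "('i \<Rightarrow> 'b) set gorder" where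
  "coprod_neg = frame_coprod I (\<lambda>i. neg (\<L> i))"

definition inj_pos :: "'i \<Rightarrow> 'a \<Rightarrow> ('i \<Rightarrow> 'a) set" where
  "inj_pos j = (\<lambda>a\<in>carrier (pos (\<L> j)).
     oplus I (\<lambda>i. pos (\<L> i)) j a (res_top I (\<lambda>i. pos (\<L> i))))"

definition inj_neg :: "'i \<Rightarrow> 'b \<Rightarrow> ('i \<Rightarrow> 'b) set" where
  "inj_neg j = (\<lambda>b\<in>carrier (neg (\<L> j)).
     oplus I (\<lambda>i. neg (\<L> i)) j b (res_top I (\<lambda>i. neg (\<L> i))))"

definition con1 :: "(('i \<Rightarrow> 'a) set \<times> ('i \<Rightarrow> 'b) set) set" where
  "con1 = {(inj_pos j a, inj_neg j b) | j a b. j \<in> I \<and> (a, b) \<in> con (\<L> j)}"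

definition tot1 :: "(('i \<Rightarrow> 'a) set \<times> ('i \<Rightarrow> 'b) set) set" where
  "tot1 = {(inj_pos j a, inj_neg j b) | j a b. j \<in> I \<and> (a, b) \<in> tot (\<L> j)}"

definition Con_star :: "(('i \<Rightarrow> 'a) set \<times> ('i \<Rightarrow> 'b) set) set" where
  "Con_star = \<Inter> {X. X \<subseteq> carrier coprod_pos \<times> carrier coprod_neg \<and>
     con1 \<subseteq> X \<and> tt coprod_pos coprod_neg \<in> X \<and> ff coprod_pos coprod_neg \<in> X \<and>
     info_down_closed coprod_pos coprod_neg X \<and>
     log_closed coprod_pos coprod_neg X \<and>
     directed_join_closed coprod_pos coprod_neg X}"

definition Tot_star :: "(('i \<Rightarrow> 'a) set \<times> ('i \<Rightarrow> 'b) set) set" where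
  "Tot_star = \<Inter> {X. X \<subseteq> carrier coprod_pos \<times> carrier coprod_neg \<and>
     tot1 \<subseteq> X \<and> tt coprod_pos coprod_neg \<in> X \<and> ff coprod_pos coprod_neg \<in> X \<and>
     info_up_closed coprod_pos coprod_neg X \<and>
     log_closed coprod_pos coprod_neg X}"

definition dframe_coprod :: "(('i \<Rightarrow> 'a) set, ('i \<Rightarrow> 'b) set) dframe" where
  "dframe_coprod = \<lparr>pos = coprod_pos, neg = coprod_neg, con = Con_star, tot = Tot_star\<rparr>"

definition dframe_inj :: "'i \<Rightarrow> ('a \<Rightarrow> ('i \<Rightarrow> 'a) set) \<times> ('b \<Rightarrow> ('i \<Rightarrow> 'b) set)" where
  "dframe_inj j = (inj_pos j, inj_neg j)"

end

end

theory Submission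
  imports Defs
begin

text \<open>The frames of the coproduct are presented by C-ideals, so a frame homomorphism out of them is
  given on a generator \<open>u\<close> by the meet of the \<open>f i (u i)\<close>; the finite support of \<open>u\<close> makes it
  unique. The only d-frame axiom that is not built into the closures defining \<open>Con_star\<close> and
  \<open>Tot_star\<close> is (con-tot). For it, \<open>Con_star\<close> is bounded by the pairs \<open>(U, V)\<close> such that any
  \<open>u \<in> U\<close> and \<open>v \<in> V\<close> satisfy \<open>(u j, v j) \<in> con (\<L> j)\<close> for some \<open>j\<close>: this relation between \<open>u\<close>
  and \<open>v\<close> defines a C-ideal in each variable, hence the bound is closed under all the operations.
  \<open>Tot_star\<close> is bounded by the pairs that lie above a finite disjunctive normal form in elements of
  the \<open>tot (\<L> j)\<close>. Comparing the two bounds reduces (con-tot) to the same axiom in a single \<open>\<L> j\<close>;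
  the other half follows by exchanging the two frames.\<close>

section \<open>Frames\<close>

text \<open>The condition (con-tot) links a member of \<open>Con_star\<close> with a member of
  \<open>Tot_star\<close> through an equation between components. An equation between joins or meets
  says nothing about their parts, so a direct induction along the two closures stalls. What survives
  the closure steps is a property of single tuples, and both bounds are phrased through tuples:
  universally for con (every \<open>u \<in> U\<close> against every \<open>v \<in> V\<close>),
  existentially for tot (finitely many tuples in \<open>U\<close> that control membership in
  \<open>V\<close>). A disjunctive normal form is chosen because the first component of each clause
  is then one tuple, at which the con relation can be evaluated; the second components occur only as
  upper bounds for the coordinates of \<open>v\<close>. Such a witness treats the two frames
  differently, and this is why the comparison yields just the case of equal first components. The
  delicate closure property is that of the bound for tot under logical meets: a tuple below a join
  of two clauses need not lie below either of them, and it has to be cut into pieces by finitely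
  many covers.\<close>

context frame
begin

lemma sup_empty: "\<Squnion>{} = \<bottom>"
  using weak_sup_empty by (simp add: eq_is_equal)

lemma le_bottom_eq: "\<lbrakk>x \<in> carrier L; x \<sqsubseteq> \<bottom>\<rbrakk> \<Longrightarrow> x = \<bottom>"
  by (simp add: le_antisym)

lemma top_le_eq: "\<lbrakk>x \<in> carrier L; \<top> \<sqsubseteq> x\<rbrakk> \<Longrightarrow> x = \<top>"
  by (simp add: le_antisym)

lemma meet_absorb: "\<lbrakk>x \<in> carrier L; y \<in> carrier L; x \<sqsubseteq> y\<rbrakk> \<Longrightarrow> x \<sqinter> y = x"
  using le_iff_join by simp

text \<open>An element below a join is the join of its own pieces. In this form a cover can reach a
  tuple whose coordinate lies merely below a join.\<close>

lemma sup_meet_eq: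
  "\<lbrakk>x \<in> carrier L; A \<subseteq> carrier L; x \<sqsubseteq> \<Squnion>A\<rbrakk> \<Longrightarrow> \<Squnion>((\<lambda>a. x \<sqinter> a) ` A) = x"
  using meet_sup_distrib[of x A] meet_absorb[of x "\<Squnion>A"] by simp

text \<open>Distributivity used once in each argument. It is the reason the copairing preserves
  meets, where both factors are joins of values on tuples.\<close>

lemma sup_meet_sup:
  assumes "A \<subseteq> carrier L" "B \<subseteq> carrier L"
  shows "\<Squnion>A \<sqinter> \<Squnion>B = \<Squnion>{a \<sqinter> b | a b. a \<in> A \<and> b \<in> B}" (is "_ = \<Squnion>?C")
proof (rule le_antisym)
  have C: "?C \<subseteq> carrier L" using assms by (auto intro!: meet_closed)
  have "\<Squnion>A \<sqinter> \<Squnion>B = \<Squnion>((\<lambda>b. \<Squnion>A \<sqinter> b) ` B)"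
    using assms by (simp add: meet_sup_distrib)
  also have "\<dots> \<sqsubseteq> \<Squnion>?C"
  proof (rule sup_least)
    fix x assume "x \<in> (\<lambda>b. \<Squnion>A \<sqinter> b) ` B"
    then obtain b where b: "b \<in> B" "b \<in> carrier L" and x: "x = \<Squnion>A \<sqinter> b" using assms by auto
    have "x = \<Squnion>((\<lambda>a. b \<sqinter> a) ` A)"
      using x b assms by (simp add: meet_sup_distrib meet_comm[of L "\<Squnion>A" b])
    also have "\<dots> \<sqsubseteq> \<Squnion>?C"
    proof (rule sup_least)
      fix y assume "y \<in> (\<lambda>a. b \<sqinter> a) ` A"
      then have "y \<in> ?C" using b by (auto simp: meet_comm[of L b])
      then show "y \<sqsubseteq> \<Squnion>?C" using C by (simp add: sup_upper)
    qed (use C assms b in auto)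
    finally show "x \<sqsubseteq> \<Squnion>?C" .
  qed (use C assms in auto)
  finally show "\<Squnion>A \<sqinter> \<Squnion>B \<sqsubseteq> \<Squnion>?C" .
  show "\<Squnion>?C \<sqsubseteq> \<Squnion>A \<sqinter> \<Squnion>B"
  proof (rule sup_least)
    fix x assume "x \<in> ?C"
    then obtain a b where ab: "a \<in> A" "b \<in> B" "x = a \<sqinter> b" by auto
    then have c: "a \<in> carrier L" "b \<in> carrier L" using assms by auto
    have "a \<sqinter> b \<sqsubseteq> \<Squnion>A" "a \<sqinter> b \<sqsubseteq> \<Squnion>B"
      using ab c assms sup_upper meet_left meet_right
      by (meson le_trans meet_closed sup_closed)+
    then show "x \<sqsubseteq> \<Squnion>A \<sqinter> \<Squnion>B" using ab c assms by (simp add: meet_le)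
  qed (use C assms in auto)
qed (use assms in \<open>auto intro!: sup_closed meet_closed\<close>)

end

section \<open>Frame homomorphisms\<close>

lemma frame_homD:
  assumes "h \<in> frame_hom L M"
  shows "h \<in> extensional (carrier L)"
    and "x \<in> carrier L \<Longrightarrow> h x \<in> carrier M"
    and "h \<top>\<^bsub>L\<^esub> = \<top>\<^bsub>M\<^esub>"
    and "\<lbrakk>x \<in> carrier L; y \<in> carrier L\<rbrakk> \<Longrightarrow> h (x \<sqinter>\<^bsub>L\<^esub> y) = h x \<sqinter>\<^bsub>M\<^esub> h y"
    and "A \<subseteq> carrier L \<Longrightarrow> h (\<Squnion>\<^bsub>L\<^esub> A) = \<Squnion>\<^bsub>M\<^esub> (h ` A)"
  using assms by (auto simp: frame_hom_def PiE_def)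

lemma frame_hom_join:
  assumes "h \<in> frame_hom L M" "x \<in> carrier L" "y \<in> carrier L"
  shows "h (x \<squnion>\<^bsub>L\<^esub> y) = h x \<squnion>\<^bsub>M\<^esub> h y"
  using frame_homD(5)[OF assms(1), of "{x, y}"] assms by (simp add: join_def)

lemma frame_hom_bottom:
  assumes "frame L" "frame M" "h \<in> frame_hom L M"
  shows "h \<bottom>\<^bsub>L\<^esub> = \<bottom>\<^bsub>M\<^esub>"
  using frame_homD(5)[OF assms(3), of "{}"] assms(1,2) by (simp add: frame.sup_empty)

lemma frame_hom_mono:
  assumes "frame L" "frame M" "h \<in> frame_hom L M"
    and "x \<in> carrier L" "y \<in> carrier L" "x \<sqsubseteq>\<^bsub>L\<^esub> y"
  shows "h x \<sqsubseteq>\<^bsub>M\<^esub> h y"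
proof -
  interpret L: frame L by fact
  interpret M: frame M by fact
  have "h x \<sqinter>\<^bsub>M\<^esub> h y = h x"
    using frame_homD(4)[OF assms(3-5)] L.meet_absorb[OF assms(4-6)] by simp
  then show ?thesis
    using frame_homD(2)[OF assms(3)] assms M.meet_right by metis
qed


section \<open>The coproduct of frames\<close>

locale frame_family =
  fixes I :: "'i set" and L :: "'i \<Rightarrow> 'a gorder"
  assumes frames: "i \<in> I \<Longrightarrow> frame (L i)"
begin

definition res_meet :: "('i \<Rightarrow> 'a) \<Rightarrow> ('i \<Rightarrow> 'a) \<Rightarrow> 'i \<Rightarrow> 'a" where
  "res_meet u v = (\<lambda>i\<in>I. u i \<sqinter>\<^bsub>L i\<^esub> v i)"

lemma res_carrier: "\<lbrakk>u \<in> res_prod I L; i \<in> I\<rbrakk> \<Longrightarrow> u i \<in> carrier (L i)"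
  by (auto simp: res_prod_def)

lemma res_eqI: "\<lbrakk>u \<in> res_prod I L; v \<in> res_prod I L; \<And>i. i \<in> I \<Longrightarrow> u i = v i\<rbrakk> \<Longrightarrow> u = v"
  by (auto simp: res_prod_def intro: PiE_ext)

lemma res_upd:
  assumes "u \<in> res_prod I L" "j \<in> I" "a \<in> carrier (L j)"
  shows "u(j := a) \<in> res_prod I L"
proof -
  have "finite {i \<in> I. u i \<noteq> \<top>\<^bsub>L i\<^esub>}" using assms(1) by (simp add: res_prod_def)
  then have "finite {i \<in> I. (u(j := a)) i \<noteq> \<top>\<^bsub>L i\<^esub>}"
    by (rule finite_subset[rotated, OF finite.insertI[of _ j]]) auto
  moreover have "u(j := a) \<in> (\<Pi>\<^sub>E i\<in>I. carrier (L i))"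
    using assms PiE_fun_upd[of a "\<lambda>i. carrier (L i)" j u I]
    by (simp add: res_prod_def insert_absorb)
  ultimately show ?thesis by (simp add: res_prod_def)
qed

lemma res_top_mem: "res_top I L \<in> res_prod I L"
proof -
  have "\<top>\<^bsub>L i\<^esub> \<in> carrier (L i)" if "i \<in> I" for i
  proof -
    interpret frame "L i" by (rule frames[OF that])
    show ?thesis by simp
  qed
  moreover have "{i \<in> I. res_top I L i \<noteq> \<top>\<^bsub>L i\<^esub>} = {}" by (auto simp: res_top_def)
  ultimately show ?thesis by (simp add: res_prod_def res_top_def)
qed

lemma res_le_refl: "u \<in> res_prod I L \<Longrightarrow> res_le I L u u"
proof -
  assume u: "u \<in> res_prod I L"
  have "u i \<sqsubseteq>\<^bsub>L i\<^esub> u i" if "i \<in> I" for i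
  proof -
    interpret frame "L i" by (rule frames[OF that])
    show ?thesis using res_carrier[OF u that] by simp
  qed
  then show ?thesis by (simp add: res_le_def)
qed

lemma res_le_trans:
  assumes "u \<in> res_prod I L" "v \<in> res_prod I L" "w \<in> res_prod I L"
    and "res_le I L u v" "res_le I L v w"
  shows "res_le I L u w"
  unfolding res_le_def
proof
  fix i assume i: "i \<in> I"
  interpret frame "L i" by (rule frames[OF i])
  show "u i \<sqsubseteq>\<^bsub>L i\<^esub> w i"
    using assms i res_carrier le_trans[of "u i" "v i" "w i"] by (simp add: res_le_def)
qed

lemma res_meet_mem:
  assumes "u \<in> res_prod I L" "v \<in> res_prod I L"
  shows "res_meet u v \<in> res_prod I L"
proof -
  have c: "u i \<sqinter>\<^bsub>L i\<^esub> v i \<in> carrier (L i)"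
    and t: "u i = \<top>\<^bsub>L i\<^esub> \<Longrightarrow> v i = \<top>\<^bsub>L i\<^esub> \<Longrightarrow> u i \<sqinter>\<^bsub>L i\<^esub> v i = \<top>\<^bsub>L i\<^esub>" if "i \<in> I" for i
  proof -
    interpret frame "L i" by (rule frames[OF that])
    show "u i \<sqinter>\<^bsub>L i\<^esub> v i \<in> carrier (L i)" using res_carrier that assms by simp
    show "u i = \<top>\<^bsub>L i\<^esub> \<Longrightarrow> v i = \<top>\<^bsub>L i\<^esub> \<Longrightarrow> u i \<sqinter>\<^bsub>L i\<^esub> v i = \<top>\<^bsub>L i\<^esub>"
      by (simp add: meet_absorb)
  qed
  have "{i \<in> I. res_meet u v i \<noteq> \<top>\<^bsub>L i\<^esub>} \<subseteq> {i \<in> I. u i \<noteq> \<top>\<^bsub>L i\<^esub>} \<union> {i \<in> I. v i \<noteq> \<top>\<^bsub>L i\<^esub>}"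
    using t by (auto simp: res_meet_def)
  then have "finite {i \<in> I. res_meet u v i \<noteq> \<top>\<^bsub>L i\<^esub>}"
    using assms by (auto simp: res_prod_def elim: finite_subset)
  then show ?thesis using c by (simp add: res_prod_def res_meet_def)
qed

lemma res_meet_le:
  assumes "u \<in> res_prod I L" "v \<in> res_prod I L"
  shows "res_le I L (res_meet u v) u" "res_le I L (res_meet u v) v"
proof -
  have "u i \<sqinter>\<^bsub>L i\<^esub> v i \<sqsubseteq>\<^bsub>L i\<^esub> u i \<and> u i \<sqinter>\<^bsub>L i\<^esub> v i \<sqsubseteq>\<^bsub>L i\<^esub> v i" if "i \<in> I" for i
  proof -
    interpret frame "L i" by (rule frames[OF that])
    show ?thesis using res_carrier that assms by (simp add: meet_left meet_right)
  qed
  then show "res_le I L (res_meet u v) u" "res_le I L (res_meet u v) v"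
    by (simp_all add: res_le_def res_meet_def)
qed

lemma res_meet_mono:
  assumes "u \<in> res_prod I L" "v \<in> res_prod I L" "w \<in> res_prod I L" "res_le I L u v"
  shows "res_le I L (res_meet w u) (res_meet w v)"
  unfolding res_le_def
proof
  fix i assume i: "i \<in> I"
  interpret frame "L i" by (rule frames[OF i])
  have c: "u i \<in> carrier (L i)" "v i \<in> carrier (L i)" "w i \<in> carrier (L i)"
    using res_carrier i assms by auto
  have "u i \<sqsubseteq>\<^bsub>L i\<^esub> v i" using assms i by (simp add: res_le_def)
  then have "w i \<sqinter>\<^bsub>L i\<^esub> u i \<sqsubseteq>\<^bsub>L i\<^esub> w i \<sqinter>\<^bsub>L i\<^esub> v i"
    using c by (meson le_trans meet_closed meet_le meet_left meet_right)
  then show "res_meet w u i \<sqsubseteq>\<^bsub>L i\<^esub> res_meet w v i" using i by (simp add: res_meet_def)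
qed

section \<open>C-ideals and the frame that they form\<close>

lemma C_idealI:
  assumes "J \<subseteq> res_prod I L"
    and "\<And>u v. \<lbrakk>v \<in> J; u \<in> res_prod I L; res_le I L u v\<rbrakk> \<Longrightarrow> u \<in> J"
    and "\<And>j A u. \<lbrakk>j \<in> I; A \<subseteq> carrier (L j); u \<in> res_prod I L; \<And>a. a \<in> A \<Longrightarrow> u(j := a) \<in> J\<rbrakk>
           \<Longrightarrow> u(j := \<Squnion>\<^bsub>L j\<^esub> A) \<in> J"
  shows "C_ideal I L J"
  using assms unfolding C_ideal_def coverage_def by (auto simp: image_subset_iff)

lemma C_ideal_subset: "C_ideal I L J \<Longrightarrow> J \<subseteq> res_prod I L"
  by (simp add: C_ideal_def)

lemma C_ideal_down: "\<lbrakk>C_ideal I L J; v \<in> J; u \<in> res_prod I L; res_le I L u v\<rbrakk> \<Longrightarrow> u \<in> J"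
  by (auto simp: C_ideal_def)

lemma C_ideal_cover:
  assumes "C_ideal I L J" "j \<in> I" "A \<subseteq> carrier (L j)" "u \<in> res_prod I L"
    and "\<And>a. a \<in> A \<Longrightarrow> u(j := a) \<in> J"
  shows "u(j := \<Squnion>\<^bsub>L j\<^esub> A) \<in> J"
proof -
  have "((\<lambda>a. u(j := a)) ` A, u(j := \<Squnion>\<^bsub>L j\<^esub> A)) \<in> coverage I L"
    using assms by (auto simp: coverage_def)
  moreover have "(\<lambda>a. u(j := a)) ` A \<subseteq> J" using assms by auto
  ultimately show ?thesis using assms(1) by (auto simp: C_ideal_def)
qed

text \<open>The cover by the empty family has no premise, and its conclusion is a tuple with
  \<open>\<bottom>\<close> at the chosen coordinate; every null tuple is such a conclusion.\<close>

lemma null_subset_C_ideal: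
  assumes "C_ideal I L J" shows "null_ideal I L \<subseteq> J"
proof
  fix u assume "u \<in> null_ideal I L"
  then obtain i where i: "i \<in> I" "u \<in> res_prod I L" "u i = \<bottom>\<^bsub>L i\<^esub>" by (auto simp: null_ideal_def)
  interpret frame "L i" by (rule frames[OF i(1)])
  have "u(i := \<Squnion>\<^bsub>L i\<^esub> {}) \<in> J" using C_ideal_cover[OF assms i(1) _ i(2)] by auto
  then show "u \<in> J" using i(3) by (simp add: sup_empty) (metis fun_upd_triv)
qed

lemma null_down:
  assumes "v \<in> null_ideal I L" "u \<in> res_prod I L" "res_le I L u v"
  shows "u \<in> null_ideal I L"
proof -
  obtain i where i: "i \<in> I" "v i = \<bottom>\<^bsub>L i\<^esub>" using assms(1) by (auto simp: null_ideal_def)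
  interpret frame "L i" by (rule frames[OF i(1)])
  have "u i = \<bottom>\<^bsub>L i\<^esub>"
    using assms i le_bottom_eq[of "u i"] res_carrier[OF assms(2) i(1)] by (auto simp: res_le_def)
  then show ?thesis using assms(2) i(1) by (auto simp: null_ideal_def)
qed

lemma C_ideal_res_prod: "C_ideal I L (res_prod I L)"
proof (rule C_idealI)
  fix j A u assume j: "j \<in> I" "A \<subseteq> carrier (L j)" "u \<in> res_prod I L"
  interpret frame "L j" by (rule frames) fact
  show "u(j := \<Squnion>\<^bsub>L j\<^esub> A) \<in> res_prod I L" using j by (simp add: res_upd)
qed auto

lemma C_ideal_Inter:
  assumes "\<And>J. J \<in> \<A> \<Longrightarrow> C_ideal I L J" "\<A> \<noteq> {}"
  shows "C_ideal I L (\<Inter>\<A>)"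
proof (rule C_idealI)
  show "\<Inter>\<A> \<subseteq> res_prod I L" using assms C_ideal_subset by blast
  show "u \<in> \<Inter>\<A>" if "v \<in> \<Inter>\<A>" "u \<in> res_prod I L" "res_le I L u v" for u v
    using that assms C_ideal_down by blast
  show "u(j := \<Squnion>\<^bsub>L j\<^esub> A) \<in> \<Inter>\<A>" if "j \<in> I" "A \<subseteq> carrier (L j)" "u \<in> res_prod I L"
    "\<And>a. a \<in> A \<Longrightarrow> u(j := a) \<in> \<Inter>\<A>" for j A u
    using that(4) C_ideal_cover[OF assms(1) that(1-3)] by (intro InterI) simp
qed

lemma C_ideal_Int: "\<lbrakk>C_ideal I L J; C_ideal I L K\<rbrakk> \<Longrightarrow> C_ideal I L (J \<inter> K)"
  using C_ideal_Inter[of "{J, K}"] by auto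

lemma coprod_simps [simp]:
  "carrier (frame_coprod I L) = {J. C_ideal I L J}"
  "le (frame_coprod I L) = (\<subseteq>)"
  "eq (frame_coprod I L) = (=)"
  by (simp_all add: frame_coprod_def)

lemma coprod_complete_lattice: "complete_lattice (frame_coprod I L)"
proof -
  interpret partial_order "frame_coprod I L"
    by unfold_locales (auto simp: frame_coprod_def)
  show ?thesis
  proof (rule complete_lattice_criterion1)
    show "\<exists>g. greatest (frame_coprod I L) g (carrier (frame_coprod I L))"
      by (rule exI[of _ "res_prod I L"]) (auto simp: greatest_def C_ideal_res_prod C_ideal_subset)
    fix A assume A: "A \<subseteq> carrier (frame_coprod I L)" "A \<noteq> {}"
    then have "C_ideal I L (\<Inter>A)" using C_ideal_Inter by auto
    then have "greatest (frame_coprod I L) (\<Inter>A) (Lower (frame_coprod I L) A)"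
      using A by (auto simp: greatest_def Lower_def)
    then show "\<exists>i. greatest (frame_coprod I L) i (Lower (frame_coprod I L) A)" ..
  qed
qed

lemma coprod_meet:
  assumes "C_ideal I L J" "C_ideal I L K"
  shows "J \<sqinter>\<^bsub>frame_coprod I L\<^esub> K = J \<inter> K"
proof -
  interpret complete_lattice "frame_coprod I L" by (rule coprod_complete_lattice)
  have "J \<sqinter>\<^bsub>frame_coprod I L\<^esub> K \<subseteq> J" "J \<sqinter>\<^bsub>frame_coprod I L\<^esub> K \<subseteq> K"
    using meet_left[of J K] meet_right[of J K] assms by auto
  moreover have "J \<inter> K \<subseteq> J \<sqinter>\<^bsub>frame_coprod I L\<^esub> K"
    using meet_le[of "J \<inter> K" J K] assms C_ideal_Int by auto
  ultimately show ?thesis by auto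
qed

lemma coprod_top: "\<top>\<^bsub>frame_coprod I L\<^esub> = res_prod I L"
proof -
  interpret complete_lattice "frame_coprod I L" by (rule coprod_complete_lattice)
  show ?thesis
    using top_closed top_higher[of "res_prod I L"] C_ideal_res_prod C_ideal_subset by auto
qed

text \<open>A join of C-ideals has no simple description by elements. Later statements about all
  tuples of a join come from the third clause: the tuples with the desired property are shown to
  form a C-ideal that contains every member of \<open>\<A>\<close>.\<close>

lemma coprod_sup:
  assumes "\<And>J. J \<in> \<A> \<Longrightarrow> C_ideal I L J"
  shows "C_ideal I L (\<Squnion>\<^bsub>frame_coprod I L\<^esub> \<A>)"
    and "J \<in> \<A> \<Longrightarrow> J \<subseteq> \<Squnion>\<^bsub>frame_coprod I L\<^esub> \<A>"
    and "\<lbrakk>C_ideal I L K; \<And>J. J \<in> \<A> \<Longrightarrow> J \<subseteq> K\<rbrakk> \<Longrightarrow> \<Squnion>\<^bsub>frame_coprod I L\<^esub> \<A> \<subseteq> K"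
proof -
  interpret complete_lattice "frame_coprod I L" by (rule coprod_complete_lattice)
  have A: "\<A> \<subseteq> carrier (frame_coprod I L)" using assms by auto
  show "C_ideal I L (\<Squnion>\<^bsub>frame_coprod I L\<^esub> \<A>)" using sup_closed[OF A] by simp
  show "J \<in> \<A> \<Longrightarrow> J \<subseteq> \<Squnion>\<^bsub>frame_coprod I L\<^esub> \<A>" using sup_upper[OF A] by simp
  show "\<lbrakk>C_ideal I L K; \<And>J. J \<in> \<A> \<Longrightarrow> J \<subseteq> K\<rbrakk> \<Longrightarrow> \<Squnion>\<^bsub>frame_coprod I L\<^esub> \<A> \<subseteq> K"
    using sup_least[OF A, of K] by simp
qed

text \<open>This set is the Heyting implication from \<open>S\<close> to \<open>K\<close>. It is a
  C-ideal because covers are stable under meets with a fixed tuple, and this residual is what makes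
  the lattice of C-ideals distributive.\<close>

lemma C_ideal_residual:
  assumes K: "C_ideal I L K" and S: "S \<subseteq> res_prod I L"
  shows "C_ideal I L {v \<in> res_prod I L. \<forall>u\<in>S. res_meet u v \<in> K}"
proof (rule C_idealI)
  fix v w
  assume v: "v \<in> {v \<in> res_prod I L. \<forall>u\<in>S. res_meet u v \<in> K}"
    and w: "w \<in> res_prod I L" "res_le I L w v"
  have "res_meet u w \<in> K" if "u \<in> S" for u
    using C_ideal_down[OF K, of "res_meet u v" "res_meet u w"] res_meet_mono[of w v u]
      res_meet_mem[of u w] v w that S by blast
  then show "w \<in> {v \<in> res_prod I L. \<forall>u\<in>S. res_meet u v \<in> K}" using w by blast
next
  fix j A v
  assume j: "j \<in> I" and A: "A \<subseteq> carrier (L j)" and v: "v \<in> res_prod I L"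
    and sub: "\<And>a. a \<in> A \<Longrightarrow> v(j := a) \<in> {v \<in> res_prod I L. \<forall>u\<in>S. res_meet u v \<in> K}"
  interpret frame "L j" by (rule frames[OF j])
  have "res_meet u (v(j := \<Squnion>\<^bsub>L j\<^esub> A)) \<in> K" if u: "u \<in> S" for u
  proof -
    have uj: "u j \<in> carrier (L j)" using u S j res_carrier by auto
    have upd: "res_meet u (v(j := a)) = (res_meet u v)(j := u j \<sqinter>\<^bsub>L j\<^esub> a)" for a
      using j by (auto simp: res_meet_def fun_eq_iff)
    have "(res_meet u v)(j := \<Squnion>\<^bsub>L j\<^esub> ((\<lambda>a. u j \<sqinter>\<^bsub>L j\<^esub> a) ` A)) \<in> K"
    proof (rule C_ideal_cover[OF K j])
      show "(\<lambda>a. u j \<sqinter>\<^bsub>L j\<^esub> a) ` A \<subseteq> carrier (L j)" using uj A by auto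
      show "res_meet u v \<in> res_prod I L" using u S v by (auto intro: res_meet_mem)
      fix b assume "b \<in> (\<lambda>a. u j \<sqinter>\<^bsub>L j\<^esub> a) ` A"
      then show "(res_meet u v)(j := b) \<in> K" using sub u upd by fastforce
    qed
    \<comment> \<open>The meet of \<open>u\<close> with a cover at coordinate \<open>j\<close> is
      again a cover at \<open>j\<close>, by the frame law of \<open>L j\<close>.\<close>
    then show ?thesis unfolding upd using uj A by (simp add: meet_sup_distrib)
  qed
  moreover have "v(j := \<Squnion>\<^bsub>L j\<^esub> A) \<in> res_prod I L" using res_upd[OF v j] A by simp
  ultimately show "v(j := \<Squnion>\<^bsub>L j\<^esub> A) \<in> {v \<in> res_prod I L. \<forall>u\<in>S. res_meet u v \<in> K}"
    by blast
qed auto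

lemma C_ideal_res_meet:
  assumes "C_ideal I L J" "C_ideal I L K" "u \<in> J" "v \<in> K"
  shows "res_meet u v \<in> J \<inter> K"
proof -
  have uv: "u \<in> res_prod I L" "v \<in> res_prod I L" using assms C_ideal_subset by auto
  show ?thesis
    using C_ideal_down[OF assms(1,3) res_meet_mem[OF uv] res_meet_le(1)[OF uv]]
      C_ideal_down[OF assms(2,4) res_meet_mem[OF uv] res_meet_le(2)[OF uv]] by simp
qed

lemma res_meet_idem: "u \<in> res_prod I L \<Longrightarrow> res_meet u u = u"
proof (rule res_eqI)
  fix i assume u: "u \<in> res_prod I L" and i: "i \<in> I"
  interpret frame "L i" by (rule frames[OF i])
  show "res_meet u u i = u i" using i res_carrier[OF u i] by (simp add: res_meet_def meet_absorb)
qed (auto intro: res_meet_mem)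

lemma coprod_frame: "frame (frame_coprod I L)"
proof -
  interpret complete_lattice "frame_coprod I L" by (rule coprod_complete_lattice)
  show "frame (frame_coprod I L)"
  proof unfold_locales
    fix J \<A> assume J: "J \<in> carrier (frame_coprod I L)" and "\<A> \<subseteq> carrier (frame_coprod I L)"
    then have CJ: "C_ideal I L J" and A: "\<And>K. K \<in> \<A> \<Longrightarrow> C_ideal I L K" by auto
    define \<B> where "\<B> = (\<lambda>x. J \<sqinter>\<^bsub>frame_coprod I L\<^esub> x) ` \<A>"
    have \<B>: "\<B> = (\<lambda>K. J \<inter> K) ` \<A>"
      unfolding \<B>_def using coprod_meet CJ A by (intro image_cong) auto
    have B: "\<And>K. K \<in> \<B> \<Longrightarrow> C_ideal I L K" using \<B> CJ A C_ideal_Int by auto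
    have CK: "C_ideal I L (\<Squnion>\<^bsub>frame_coprod I L\<^esub> \<B>)" using coprod_sup B by blast
    have "J \<inter> \<Squnion>\<^bsub>frame_coprod I L\<^esub> \<A> \<subseteq> \<Squnion>\<^bsub>frame_coprod I L\<^esub> \<B>"
    proof
      fix v assume v: "v \<in> J \<inter> \<Squnion>\<^bsub>frame_coprod I L\<^esub> \<A>"
      \<comment> \<open>The residual \<open>?R\<close> absorbs every \<open>K \<in> \<A>\<close> and
        hence the whole join. For \<open>v\<close> that also lies in \<open>J\<close>, the instance
        \<open>u = v\<close> together with idempotence of \<open>res_meet\<close> puts
        \<open>v\<close> itself into the join of the meets.\<close>
      let ?R = "{v \<in> res_prod I L. \<forall>u\<in>J. res_meet u v \<in> \<Squnion>\<^bsub>frame_coprod I L\<^esub> \<B>}"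
      have "\<Squnion>\<^bsub>frame_coprod I L\<^esub> \<A> \<subseteq> ?R"
      proof (rule coprod_sup(3)[OF A])
        show "C_ideal I L ?R" using CK CJ C_ideal_subset C_ideal_residual by blast
        fix K assume K: "K \<in> \<A>"
        then have "J \<inter> K \<subseteq> \<Squnion>\<^bsub>frame_coprod I L\<^esub> \<B>" using coprod_sup(2)[OF B] \<B> by blast
        then show "K \<subseteq> ?R" using C_ideal_res_meet[OF CJ A[OF K]] C_ideal_subset[OF A[OF K]] by blast
      qed
      then show "v \<in> \<Squnion>\<^bsub>frame_coprod I L\<^esub> \<B>" using v res_meet_idem[of v] by fastforce
    qed
    moreover have "\<Squnion>\<^bsub>frame_coprod I L\<^esub> \<B> \<subseteq> J \<inter> \<Squnion>\<^bsub>frame_coprod I L\<^esub> \<A>"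
    proof (rule coprod_sup(3)[OF B])
      show "C_ideal I L (J \<inter> \<Squnion>\<^bsub>frame_coprod I L\<^esub> \<A>)" using C_ideal_Int[OF CJ] coprod_sup(1) A by blast
      show "K \<subseteq> J \<inter> \<Squnion>\<^bsub>frame_coprod I L\<^esub> \<A>" if "K \<in> \<B>" for K
        using that \<B> coprod_sup(2)[OF A] by blast
    qed
    ultimately show "J \<sqinter>\<^bsub>frame_coprod I L\<^esub> \<Squnion>\<^bsub>frame_coprod I L\<^esub> \<A> =
        \<Squnion>\<^bsub>frame_coprod I L\<^esub> ((\<lambda>x. J \<sqinter>\<^bsub>frame_coprod I L\<^esub> x) ` \<A>)"
      using coprod_meet[OF CJ coprod_sup(1)[OF A]] unfolding \<B>_def by auto
  qed
qed

text \<open>Null tuples are forced into every C-ideal by the empty covers. Once they are adjoined,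
  only covers by nonempty families remain to be checked, and for those all the premises may be
  assumed to lie in \<open>K\<close> itself.\<close>

lemma C_ideal_union_null:
  assumes sub: "K \<subseteq> res_prod I L"
    and down: "\<And>u v. \<lbrakk>v \<in> K; u \<in> res_prod I L; res_le I L u v\<rbrakk> \<Longrightarrow> u \<in> K"
    and cover: "\<And>j A u. \<lbrakk>j \<in> I; A \<subseteq> carrier (L j); A \<noteq> {}; u \<in> res_prod I L;
      \<And>a. a \<in> A \<Longrightarrow> u(j := a) \<in> K\<rbrakk> \<Longrightarrow> u(j := \<Squnion>\<^bsub>L j\<^esub> A) \<in> K"
  shows "C_ideal I L (K \<union> null_ideal I L)"
proof (rule C_idealI)
  show "K \<union> null_ideal I L \<subseteq> res_prod I L" using sub by (auto simp: null_ideal_def)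
  show "u \<in> K \<union> null_ideal I L"
    if "v \<in> K \<union> null_ideal I L" "u \<in> res_prod I L" "res_le I L u v" for u v
    using that down[of v u] null_down[of v u] by blast
  fix j A u
  assume j: "j \<in> I" and A: "A \<subseteq> carrier (L j)" and u: "u \<in> res_prod I L"
    and mem: "\<And>a. a \<in> A \<Longrightarrow> u(j := a) \<in> K \<union> null_ideal I L"
  interpret frame "L j" by (rule frames[OF j])
  have mem': "u(j := \<Squnion>\<^bsub>L j\<^esub> A) \<in> res_prod I L" using res_upd[OF u j] A by simp
  \<comment> \<open>Elements equal to \<open>\<bottom>\<close> leave the join unchanged, but their
    tuples are null and may lie outside \<open>K\<close>. After their removal a tuple
    \<open>u(j := a)\<close> can be null only through another coordinate of \<open>u\<close>, in
    which case the conclusion is null too.\<close>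
  define A' where "A' = {a \<in> A. a \<noteq> \<bottom>\<^bsub>L j\<^esub>}"
  have A': "A' \<subseteq> carrier (L j)" using A by (auto simp: A'_def)
  have supA': "\<Squnion>\<^bsub>L j\<^esub> A = \<Squnion>\<^bsub>L j\<^esub> A'"
  proof (rule le_antisym)
    show "\<Squnion>\<^bsub>L j\<^esub> A \<sqsubseteq>\<^bsub>L j\<^esub> \<Squnion>\<^bsub>L j\<^esub> A'"
    proof (rule sup_least)
      fix a assume "a \<in> A"
      then show "a \<sqsubseteq>\<^bsub>L j\<^esub> \<Squnion>\<^bsub>L j\<^esub> A'"
        using A' sup_upper[OF A', of a] by (cases "a = \<bottom>\<^bsub>L j\<^esub>") (auto simp: A'_def)
    qed (use A A' in auto)
    show "\<Squnion>\<^bsub>L j\<^esub> A' \<sqsubseteq>\<^bsub>L j\<^esub> \<Squnion>\<^bsub>L j\<^esub> A"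
      by (rule sup_least) (use A A' sup_upper[OF A] in \<open>auto simp: A'_def\<close>)
  qed (use A A' in auto)
  show "u(j := \<Squnion>\<^bsub>L j\<^esub> A) \<in> K \<union> null_ideal I L"
  proof (cases "\<exists>i\<in>I. i \<noteq> j \<and> u i = \<bottom>\<^bsub>L i\<^esub>")
    case True
    then have "u(j := \<Squnion>\<^bsub>L j\<^esub> A) \<in> null_ideal I L" using mem' by (auto simp: null_ideal_def)
    then show ?thesis ..
  next
    case False
    show ?thesis
    proof (cases "A' = {}")
      case True
      then have "\<Squnion>\<^bsub>L j\<^esub> A = \<bottom>\<^bsub>L j\<^esub>" using supA' sup_empty by simp
      then have "u(j := \<Squnion>\<^bsub>L j\<^esub> A) \<in> null_ideal I L"
        using mem' j by (auto simp: null_ideal_def)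
      then show ?thesis ..
    next
      case A'ne: False
      have "u(j := a) \<in> K" if "a \<in> A'" for a
      proof -
        have "u(j := a) \<notin> null_ideal I L"
          using that False by (auto simp: null_ideal_def A'_def)
        then show ?thesis using mem[of a] that by (auto simp: A'_def)
      qed
      then show ?thesis using cover[OF j A' A'ne u] supA' by simp
    qed
  qed
qed

lemma C_ideal_null: "C_ideal I L (null_ideal I L)"
  using C_ideal_union_null[of "{}"] by fastforce

lemma coprod_bottom: "\<bottom>\<^bsub>frame_coprod I L\<^esub> = null_ideal I L"
proof -
  interpret F: frame "frame_coprod I L" by (rule coprod_frame)
  have "\<bottom>\<^bsub>frame_coprod I L\<^esub> \<subseteq> null_ideal I L"
    using F.bottom_lower[of "null_ideal I L"] C_ideal_null by simp
  moreover have "null_ideal I L \<subseteq> \<bottom>\<^bsub>frame_coprod I L\<^esub>"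
    using null_subset_C_ideal F.bottom_closed by simp
  ultimately show ?thesis ..
qed

text \<open>One shape covers both kinds of basic ideals: \<open>F = {j}\<close> gives the images of
  the injections, \<open>F = I\<close> the principal ideals. A finite \<open>F\<close> lets the
  second kind be reached from the first by induction. The bound \<open>w\<close> is arbitrary
  outside \<open>F\<close>, so it need not have finite support.\<close>

definition cylinder :: "'i set \<Rightarrow> ('i \<Rightarrow> 'a) \<Rightarrow> ('i \<Rightarrow> 'a) set" where
  "cylinder F w = {v \<in> res_prod I L. \<forall>i\<in>F. v i \<sqsubseteq>\<^bsub>L i\<^esub> w i} \<union> null_ideal I L"

lemma C_ideal_cylinder:
  assumes F: "F \<subseteq> I" and w: "\<And>i. i \<in> F \<Longrightarrow> w i \<in> carrier (L i)"
  shows "C_ideal I L (cylinder F w)"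
  unfolding cylinder_def
proof (rule C_ideal_union_null)
  fix u v
  assume v: "v \<in> {v \<in> res_prod I L. \<forall>i\<in>F. v i \<sqsubseteq>\<^bsub>L i\<^esub> w i}"
    and u: "u \<in> res_prod I L" "res_le I L u v"
  have "u i \<sqsubseteq>\<^bsub>L i\<^esub> w i" if "i \<in> F" for i
  proof -
    have i: "i \<in> I" using that F by auto
    interpret frame "L i" by (rule frames[OF i])
    show ?thesis
      using u v that w le_trans[of "u i" "v i" "w i"] res_carrier[of _ i] i
      by (auto simp: res_le_def)
  qed
  then show "u \<in> {v \<in> res_prod I L. \<forall>i\<in>F. v i \<sqsubseteq>\<^bsub>L i\<^esub> w i}" using u by simp
next
  fix j A u
  assume j: "j \<in> I" and A: "A \<subseteq> carrier (L j)" "A \<noteq> {}" and u: "u \<in> res_prod I L"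
    and mem: "\<And>a. a \<in> A \<Longrightarrow> u(j := a) \<in> {v \<in> res_prod I L. \<forall>i\<in>F. v i \<sqsubseteq>\<^bsub>L i\<^esub> w i}"
  interpret frame "L j" by (rule frames[OF j])
  have "(u(j := \<Squnion>\<^bsub>L j\<^esub> A)) i \<sqsubseteq>\<^bsub>L i\<^esub> w i" if i: "i \<in> F" for i
  proof (cases "i = j")
    case True
    then have "a \<sqsubseteq>\<^bsub>L j\<^esub> w j" if "a \<in> A" for a using mem[OF that] i by auto
    then show ?thesis using True A i w[OF i] by (auto intro!: sup_least)
  next
    case False
    \<comment> \<open>At \<open>i \<noteq> j\<close> all the tuples \<open>u(j := a)\<close> agree
      with \<open>u\<close>, so any single \<open>a \<in> A\<close> provides the bound; this is
      where the family has to be nonempty.\<close>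
    then show ?thesis using A(2) mem i by fastforce
  qed
  then show "u(j := \<Squnion>\<^bsub>L j\<^esub> A) \<in> {v \<in> res_prod I L. \<forall>i\<in>F. v i \<sqsubseteq>\<^bsub>L i\<^esub> w i}"
    using res_upd[OF u j] A by simp
qed auto

lemma cylinder_empty: "cylinder {} w = res_prod I L"
  by (auto simp: cylinder_def null_ideal_def)

lemma cylinder_insert: "cylinder (insert j F) w = cylinder {j} (\<lambda>_. w j) \<inter> cylinder F w"
  by (auto simp: cylinder_def)

section \<open>The coproduct injections of frames\<close>

definition coprod_inj :: "'i \<Rightarrow> 'a \<Rightarrow> ('i \<Rightarrow> 'a) set" where
  "coprod_inj j = (\<lambda>a\<in>carrier (L j). oplus I L j a (res_top I L))"

lemma coprod_inj_eq:
  assumes "j \<in> I" "a \<in> carrier (L j)"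
  shows "coprod_inj j a = cylinder {j} (\<lambda>_. a)"
proof -
  have "v i \<sqsubseteq>\<^bsub>L i\<^esub> \<top>\<^bsub>L i\<^esub>" if "v \<in> res_prod I L" "i \<in> I" for v i
  proof -
    interpret frame "L i" by (rule frames[OF that(2)])
    show ?thesis using res_carrier[OF that] by simp
  qed
  then show ?thesis
    using assms by (auto simp: coprod_inj_def oplus_def cylinder_def res_le_def res_top_def)
qed

lemma C_ideal_coprod_inj: "\<lbrakk>j \<in> I; a \<in> carrier (L j)\<rbrakk> \<Longrightarrow> C_ideal I L (coprod_inj j a)"
  using C_ideal_cylinder[of "{j}"] by (simp add: coprod_inj_eq)

lemma mem_coprod_inj:
  assumes "j \<in> I" "a \<in> carrier (L j)"
  shows "v \<in> coprod_inj j a \<longleftrightarrow> v \<in> res_prod I L \<and> (v j \<sqsubseteq>\<^bsub>L j\<^esub> a \<or> v \<in> null_ideal I L)"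
  using assms by (auto simp: coprod_inj_eq cylinder_def null_ideal_def)

lemma coprod_inj_hom:
  assumes j: "j \<in> I"
  shows "coprod_inj j \<in> frame_hom (L j) (frame_coprod I L)"
proof -
  interpret frame "L j" by (rule frames[OF j])
  have top: "coprod_inj j \<top>\<^bsub>L j\<^esub> = \<top>\<^bsub>frame_coprod I L\<^esub>"
    using res_carrier[OF _ j] by (auto simp: mem_coprod_inj[OF j] coprod_top)
  have meet: "coprod_inj j (a \<sqinter>\<^bsub>L j\<^esub> b) = coprod_inj j a \<sqinter>\<^bsub>frame_coprod I L\<^esub> coprod_inj j b"
    if ab: "a \<in> carrier (L j)" "b \<in> carrier (L j)" for a b
  proof -
    have "v j \<sqsubseteq>\<^bsub>L j\<^esub> a \<sqinter>\<^bsub>L j\<^esub> b \<longleftrightarrow> v j \<sqsubseteq>\<^bsub>L j\<^esub> a \<and> v j \<sqsubseteq>\<^bsub>L j\<^esub> b" if "v \<in> res_prod I L" for v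
    proof
      assume le: "v j \<sqsubseteq>\<^bsub>L j\<^esub> a \<sqinter>\<^bsub>L j\<^esub> b"
      show "v j \<sqsubseteq>\<^bsub>L j\<^esub> a \<and> v j \<sqsubseteq>\<^bsub>L j\<^esub> b"
        using le_trans[OF le meet_left[OF ab]] le_trans[OF le meet_right[OF ab]]
          ab res_carrier[OF that j] by simp
    qed (use ab res_carrier[OF that j] in \<open>simp add: meet_le\<close>)
    then show ?thesis
      using ab j by (auto simp: coprod_meet C_ideal_coprod_inj mem_coprod_inj)
  qed
  have sup: "coprod_inj j (\<Squnion>\<^bsub>L j\<^esub> A) = \<Squnion>\<^bsub>frame_coprod I L\<^esub> (coprod_inj j ` A)"
    if A: "A \<subseteq> carrier (L j)" for A
  proof
    have Ac: "a \<in> carrier (L j)" if "a \<in> A" for a using A that by auto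
    then have id: "C_ideal I L J" if "J \<in> coprod_inj j ` A" for J
      using that j by (auto intro: C_ideal_coprod_inj)
    show "\<Squnion>\<^bsub>frame_coprod I L\<^esub> (coprod_inj j ` A) \<subseteq> coprod_inj j (\<Squnion>\<^bsub>L j\<^esub> A)"
    proof (rule coprod_sup(3)[OF id])
      show "C_ideal I L (coprod_inj j (\<Squnion>\<^bsub>L j\<^esub> A))" using j A by (simp add: C_ideal_coprod_inj)
      fix J assume "J \<in> coprod_inj j ` A"
      then obtain a where a: "a \<in> A" "J = coprod_inj j a" by auto
      have "v j \<sqsubseteq>\<^bsub>L j\<^esub> \<Squnion>\<^bsub>L j\<^esub> A" if "v \<in> res_prod I L" "v j \<sqsubseteq>\<^bsub>L j\<^esub> a" for v
        using le_trans[OF that(2) sup_upper[OF A a(1)]] that a A j res_carrier Ac by simp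
      then show "J \<subseteq> coprod_inj j (\<Squnion>\<^bsub>L j\<^esub> A)"
        using a Ac A j by (auto simp: mem_coprod_inj)
    qed
    let ?S = "\<Squnion>\<^bsub>frame_coprod I L\<^esub> (coprod_inj j ` A)"
    have CS: "C_ideal I L ?S" by (rule coprod_sup(1)[OF id])
    show "coprod_inj j (\<Squnion>\<^bsub>L j\<^esub> A) \<subseteq> ?S"
    proof
      fix v assume "v \<in> coprod_inj j (\<Squnion>\<^bsub>L j\<^esub> A)"
      then have v: "v \<in> res_prod I L" and "v j \<sqsubseteq>\<^bsub>L j\<^esub> \<Squnion>\<^bsub>L j\<^esub> A \<or> v \<in> null_ideal I L"
        using mem_coprod_inj[OF j] A by auto
      from this(2) show "v \<in> ?S"
      proof
        assume "v \<in> null_ideal I L" then show ?thesis using null_subset_C_ideal[OF CS] by blast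
      next
        assume le: "v j \<sqsubseteq>\<^bsub>L j\<^esub> \<Squnion>\<^bsub>L j\<^esub> A"
        have vj: "v j \<in> carrier (L j)" using res_carrier[OF v j] .
        \<comment> \<open>The tuple \<open>v\<close> is itself the conclusion of a cover at
          \<open>j\<close>: its coordinate \<open>v j\<close> is the join of the pieces
          \<open>v j \<sqinter> a\<close>, and each piece gives a tuple in the ideal generated by
          that \<open>a\<close>.\<close>
        let ?A = "(\<lambda>a. v j \<sqinter>\<^bsub>L j\<^esub> a) ` A"
        have "v(j := \<Squnion>\<^bsub>L j\<^esub> ?A) \<in> ?S"
        proof (rule C_ideal_cover[OF CS j _ v])
          show "?A \<subseteq> carrier (L j)" using vj Ac by auto
          fix b assume "b \<in> ?A"
          then obtain a where a: "a \<in> A" "b = v j \<sqinter>\<^bsub>L j\<^esub> a" by auto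
          then have "v(j := b) \<in> coprod_inj j a"
            using vj v j Ac by (auto simp: mem_coprod_inj intro: res_upd meet_right)
          then show "v(j := b) \<in> ?S" using coprod_sup(2)[OF id] a by blast
        qed
        then show ?thesis using sup_meet_eq[OF vj A le] by simp
      qed
    qed
  qed
  have "coprod_inj j \<in> extensional (carrier (L j))"
    unfolding coprod_inj_def by (rule restrict_extensional)
  then show ?thesis
    using j top meet sup by (simp add: frame_hom_def PiE_def C_ideal_coprod_inj)
qed

text \<open>Makes \<open>cylinder I u\<close> the least C-ideal that contains \<open>u\<close>: it
  consists of the tuples below \<open>u\<close> and of the null tuples, which no C-ideal can
  avoid.\<close>

lemma principal_subset:
  assumes "C_ideal I L J" "u \<in> J"
  shows "cylinder I u \<subseteq> J"
  using null_subset_C_ideal[OF assms(1)] C_ideal_down[OF assms]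
  by (auto simp: cylinder_def res_le_def)

lemma mem_principal: "u \<in> res_prod I L \<Longrightarrow> u \<in> cylinder I u"
  using res_le_refl by (simp add: cylinder_def res_le_def)

end


section \<open>The copairing of a cocone of frames\<close>

locale frame_cocone = frame_family I L + M: frame M
  for I :: "'i set" and L :: "'i \<Rightarrow> 'a gorder" and M :: "'c gorder" +
  fixes f :: "'i \<Rightarrow> 'a \<Rightarrow> 'c"
  assumes f_hom: "i \<in> I \<Longrightarrow> f i \<in> frame_hom (L i) M"
begin

text \<open>Formally a meet over all of \<open>I\<close>, in substance a finite one: coordinates
  outside the finite support of \<open>u\<close> contribute \<open>\<top>\<close>. This makes it
  compatible with homomorphisms, which preserve finite meets.\<close>

definition tuple_meet :: "('i \<Rightarrow> 'a) \<Rightarrow> 'c" where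
  "tuple_meet u = \<Sqinter>\<^bsub>M\<^esub> ((\<lambda>i. f i (u i)) ` I)"

definition copair :: "('i \<Rightarrow> 'a) set \<Rightarrow> 'c" where
  "copair = (\<lambda>U\<in>carrier (frame_coprod I L). \<Squnion>\<^bsub>M\<^esub> (tuple_meet ` U))"

lemma f_carrier: "\<lbrakk>i \<in> I; a \<in> carrier (L i)\<rbrakk> \<Longrightarrow> f i a \<in> carrier M"
  using frame_homD(2)[OF f_hom] .

lemma f_tuple_carrier: "\<lbrakk>u \<in> res_prod I L; i \<in> I\<rbrakk> \<Longrightarrow> f i (u i) \<in> carrier M"
  by (simp add: f_carrier res_carrier)

lemma f_tuple_subset: "u \<in> res_prod I L \<Longrightarrow> (\<lambda>i. f i (u i)) ` I \<subseteq> carrier M"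
  using f_tuple_carrier by auto

lemma tuple_meet_closed: "u \<in> res_prod I L \<Longrightarrow> tuple_meet u \<in> carrier M"
  using f_tuple_subset by (simp add: tuple_meet_def)

lemma tuple_meet_lower: "\<lbrakk>u \<in> res_prod I L; i \<in> I\<rbrakk> \<Longrightarrow> tuple_meet u \<sqsubseteq>\<^bsub>M\<^esub> f i (u i)"
  unfolding tuple_meet_def by (rule M.inf_lower[OF f_tuple_subset]) auto

lemma tuple_meet_greatest:
  "\<lbrakk>u \<in> res_prod I L; z \<in> carrier M; \<And>i. i \<in> I \<Longrightarrow> z \<sqsubseteq>\<^bsub>M\<^esub> f i (u i)\<rbrakk> \<Longrightarrow> z \<sqsubseteq>\<^bsub>M\<^esub> tuple_meet u"
  unfolding tuple_meet_def by (rule M.inf_greatest[OF f_tuple_subset]) auto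

lemma tuple_meet_mono:
  assumes u: "u \<in> res_prod I L" and v: "v \<in> res_prod I L" and le: "res_le I L u v"
  shows "tuple_meet u \<sqsubseteq>\<^bsub>M\<^esub> tuple_meet v"
proof (rule tuple_meet_greatest[OF v tuple_meet_closed[OF u]])
  fix i assume i: "i \<in> I"
  have "f i (u i) \<sqsubseteq>\<^bsub>M\<^esub> f i (v i)"
    using frame_hom_mono[OF frames[OF i] M.frame_axioms f_hom[OF i]] res_carrier u v i le
    by (simp add: res_le_def)
  then show "tuple_meet u \<sqsubseteq>\<^bsub>M\<^esub> f i (v i)"
    using M.le_trans[OF tuple_meet_lower[OF u i]] tuple_meet_closed f_tuple_carrier u v i by simp
qed

lemma tuple_meet_res_meet:
  assumes u: "u \<in> res_prod I L" and v: "v \<in> res_prod I L"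
  shows "tuple_meet (res_meet u v) = tuple_meet u \<sqinter>\<^bsub>M\<^esub> tuple_meet v"
proof (rule M.le_antisym)
  note uv = res_meet_mem[OF u v]
  have c: "tuple_meet u \<in> carrier M" "tuple_meet v \<in> carrier M"
    using tuple_meet_closed u v by auto
  show "tuple_meet (res_meet u v) \<sqsubseteq>\<^bsub>M\<^esub> tuple_meet u \<sqinter>\<^bsub>M\<^esub> tuple_meet v"
    using tuple_meet_mono[OF uv] res_meet_le[OF u v] u v c tuple_meet_closed[OF uv]
    by (simp add: M.meet_le)
  show "tuple_meet u \<sqinter>\<^bsub>M\<^esub> tuple_meet v \<sqsubseteq>\<^bsub>M\<^esub> tuple_meet (res_meet u v)"
  proof (rule tuple_meet_greatest[OF uv])
    show "tuple_meet u \<sqinter>\<^bsub>M\<^esub> tuple_meet v \<in> carrier M" using c by simp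
    fix i assume i: "i \<in> I"
    have fc: "f i (u i) \<in> carrier M" "f i (v i) \<in> carrier M" using f_tuple_carrier u v i by auto
    have "tuple_meet u \<sqinter>\<^bsub>M\<^esub> tuple_meet v \<sqsubseteq>\<^bsub>M\<^esub> f i (u i)"
      using M.le_trans[OF M.meet_left[OF c] tuple_meet_lower[OF u i]] c fc by simp
    moreover have "tuple_meet u \<sqinter>\<^bsub>M\<^esub> tuple_meet v \<sqsubseteq>\<^bsub>M\<^esub> f i (v i)"
      using M.le_trans[OF M.meet_right[OF c] tuple_meet_lower[OF v i]] c fc by simp
    ultimately have "tuple_meet u \<sqinter>\<^bsub>M\<^esub> tuple_meet v \<sqsubseteq>\<^bsub>M\<^esub> f i (u i) \<sqinter>\<^bsub>M\<^esub> f i (v i)"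
      using c fc by (simp add: M.meet_le)
    then show "tuple_meet u \<sqinter>\<^bsub>M\<^esub> tuple_meet v \<sqsubseteq>\<^bsub>M\<^esub> f i (res_meet u v i)"
      using frame_homD(4)[OF f_hom[OF i]] res_carrier u v i by (simp add: res_meet_def)
  qed
qed (use u v in \<open>auto intro!: tuple_meet_closed res_meet_mem M.meet_closed\<close>)

lemma tuple_meet_null:
  assumes "u \<in> null_ideal I L"
  shows "tuple_meet u = \<bottom>\<^bsub>M\<^esub>"
proof -
  obtain i where i: "i \<in> I" "u i = \<bottom>\<^bsub>L i\<^esub>" and u: "u \<in> res_prod I L"
    using assms by (auto simp: null_ideal_def)
  have "tuple_meet u \<sqsubseteq>\<^bsub>M\<^esub> \<bottom>\<^bsub>M\<^esub>"
    using tuple_meet_lower[OF u i(1)] i frame_hom_bottom[OF frames M.frame_axioms f_hom] by simp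
  then show ?thesis using M.le_bottom_eq tuple_meet_closed[OF u] by simp
qed

text \<open>With \<open>\<top>\<close> placed at coordinate \<open>j\<close>, the rest of the tuple
  is separated from \<open>f j a\<close>, so the distributive law of \<open>M\<close> can act on
  exactly the coordinate that a cover varies.\<close>

lemma tuple_meet_upd:
  assumes u: "u \<in> res_prod I L" and j: "j \<in> I" and a: "a \<in> carrier (L j)"
  shows "tuple_meet (u(j := a)) = tuple_meet (u(j := \<top>\<^bsub>L j\<^esub>)) \<sqinter>\<^bsub>M\<^esub> f j a"
proof (rule M.le_antisym)
  interpret frame "L j" by (rule frames[OF j])
  let ?r = "u(j := \<top>\<^bsub>L j\<^esub>)"
  have r: "?r \<in> res_prod I L" and ua: "u(j := a) \<in> res_prod I L"
    using res_upd[OF u j] a by auto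
  note c = tuple_meet_closed[OF r] tuple_meet_closed[OF ua] f_carrier[OF j a]
  have "res_le I L (u(j := a)) ?r"
    using a res_le_refl[OF u] by (auto simp: res_le_def)
  then show "tuple_meet (u(j := a)) \<sqsubseteq>\<^bsub>M\<^esub> tuple_meet ?r \<sqinter>\<^bsub>M\<^esub> f j a"
    using tuple_meet_mono[OF ua r] tuple_meet_lower[OF ua j] c by (simp add: M.meet_le)
  show "tuple_meet ?r \<sqinter>\<^bsub>M\<^esub> f j a \<sqsubseteq>\<^bsub>M\<^esub> tuple_meet (u(j := a))"
  proof (rule tuple_meet_greatest[OF ua])
    fix i assume i: "i \<in> I"
    show "tuple_meet ?r \<sqinter>\<^bsub>M\<^esub> f j a \<sqsubseteq>\<^bsub>M\<^esub> f i ((u(j := a)) i)"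
    proof (cases "i = j")
      case True then show ?thesis using M.meet_right[OF c(1,3)] by simp
    next
      case False
      then show ?thesis
        using M.le_trans[OF M.meet_left[OF c(1,3)] tuple_meet_lower[OF r i]] c
          f_tuple_carrier[OF u i] by simp
    qed
  qed (use c in simp)
  show "tuple_meet (u(j := a)) \<in> carrier M" "tuple_meet ?r \<sqinter>\<^bsub>M\<^esub> f j a \<in> carrier M"
    using c by simp_all
qed

text \<open>Sending \<open>y\<close> to this set gives the right adjoint of \<open>copair\<close>;
  that its values are C-ideals is what lets \<open>copair\<close> preserve joins. Covers are
  respected because \<open>f j\<close> preserves joins and \<open>M\<close> is distributive.\<close>

lemma C_ideal_tuple_meet_le:
  assumes y: "y \<in> carrier M"
  shows "C_ideal I L {u \<in> res_prod I L. tuple_meet u \<sqsubseteq>\<^bsub>M\<^esub> y}"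
proof (rule C_idealI)
  fix u v
  assume "v \<in> {u \<in> res_prod I L. tuple_meet u \<sqsubseteq>\<^bsub>M\<^esub> y}" "u \<in> res_prod I L" "res_le I L u v"
  then show "u \<in> {u \<in> res_prod I L. tuple_meet u \<sqsubseteq>\<^bsub>M\<^esub> y}"
    using M.le_trans[OF tuple_meet_mono[of u v], of y] y tuple_meet_closed by auto
next
  fix j A u
  assume j: "j \<in> I" and A: "A \<subseteq> carrier (L j)" and u: "u \<in> res_prod I L"
    and le: "\<And>a. a \<in> A \<Longrightarrow> u(j := a) \<in> {u \<in> res_prod I L. tuple_meet u \<sqsubseteq>\<^bsub>M\<^esub> y}"
  interpret frame "L j" by (rule frames[OF j])
  let ?r = "tuple_meet (u(j := \<top>\<^bsub>L j\<^esub>))"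
  have r: "?r \<in> carrier M" using tuple_meet_closed res_upd[OF u j] by simp
  have fA: "f j ` A \<subseteq> carrier M" using f_carrier[OF j] A by auto
  have "tuple_meet (u(j := \<Squnion>\<^bsub>L j\<^esub> A)) = ?r \<sqinter>\<^bsub>M\<^esub> \<Squnion>\<^bsub>M\<^esub> (f j ` A)"
    using tuple_meet_upd[OF u j sup_closed[OF A]] frame_homD(5)[OF f_hom[OF j] A] by simp
  also have "\<dots> = \<Squnion>\<^bsub>M\<^esub> ((\<lambda>x. ?r \<sqinter>\<^bsub>M\<^esub> x) ` f j ` A)" using r fA by (rule M.meet_sup_distrib)
  also have "\<dots> \<sqsubseteq>\<^bsub>M\<^esub> y"
  proof (rule M.sup_least)
    fix x assume "x \<in> (\<lambda>x. ?r \<sqinter>\<^bsub>M\<^esub> x) ` f j ` A"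
    then obtain a where a: "a \<in> A" "x = ?r \<sqinter>\<^bsub>M\<^esub> f j a" by auto
    then show "x \<sqsubseteq>\<^bsub>M\<^esub> y" using tuple_meet_upd[OF u j subsetD[OF A a(1)]] le[OF a(1)] by simp
  qed (use r fA y in auto)
  finally show "u(j := \<Squnion>\<^bsub>L j\<^esub> A) \<in> {u \<in> res_prod I L. tuple_meet u \<sqsubseteq>\<^bsub>M\<^esub> y}"
    using res_upd[OF u j] A by simp
qed auto

lemma tuple_meet_image: "C_ideal I L U \<Longrightarrow> tuple_meet ` U \<subseteq> carrier M"
  using C_ideal_subset tuple_meet_closed by blast

lemma copair_eq: "C_ideal I L U \<Longrightarrow> copair U = \<Squnion>\<^bsub>M\<^esub> (tuple_meet ` U)"
  by (simp add: copair_def)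

lemma copair_closed: "C_ideal I L U \<Longrightarrow> copair U \<in> carrier M"
  by (simp add: copair_eq tuple_meet_image)

lemma copair_upper: "\<lbrakk>C_ideal I L U; u \<in> U\<rbrakk> \<Longrightarrow> tuple_meet u \<sqsubseteq>\<^bsub>M\<^esub> copair U"
  by (simp add: copair_eq tuple_meet_image M.sup_upper)

lemma copair_least:
  "\<lbrakk>C_ideal I L U; y \<in> carrier M; \<And>u. u \<in> U \<Longrightarrow> tuple_meet u \<sqsubseteq>\<^bsub>M\<^esub> y\<rbrakk> \<Longrightarrow> copair U \<sqsubseteq>\<^bsub>M\<^esub> y"
  unfolding copair_eq by (rule M.sup_least[OF tuple_meet_image]) auto

lemma tuple_meet_top_upd:
  assumes j: "j \<in> I" and a: "a \<in> carrier (L j)"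
  shows "tuple_meet ((res_top I L)(j := a)) = f j a"
proof -
  let ?u = "(res_top I L)(j := a)"
  have u: "?u \<in> res_prod I L" using res_upd[OF res_top_mem j a] .
  have "f j a \<sqsubseteq>\<^bsub>M\<^esub> f i (?u i)" if i: "i \<in> I" for i
    using frame_homD(3)[OF f_hom[OF i]] f_carrier[OF j a] i by (simp add: res_top_def)
  then have "f j a \<sqsubseteq>\<^bsub>M\<^esub> tuple_meet ?u"
    using tuple_meet_greatest[OF u] f_carrier[OF j a] by simp
  moreover have "tuple_meet ?u \<sqsubseteq>\<^bsub>M\<^esub> f j a" using tuple_meet_lower[OF u j] by simp
  ultimately show ?thesis using M.le_antisym tuple_meet_closed[OF u] f_carrier[OF j a] by simp
qed

lemma copair_hom: "copair \<in> frame_hom (frame_coprod I L) M"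
proof -
  have top: "copair \<top>\<^bsub>frame_coprod I L\<^esub> = \<top>\<^bsub>M\<^esub>"
  proof -
    have "\<top>\<^bsub>M\<^esub> \<sqsubseteq>\<^bsub>M\<^esub> f i (res_top I L i)" if i: "i \<in> I" for i
      using frame_homD(3)[OF f_hom[OF i]] i by (simp add: res_top_def)
    then have "\<top>\<^bsub>M\<^esub> \<sqsubseteq>\<^bsub>M\<^esub> tuple_meet (res_top I L)"
      using tuple_meet_greatest[OF res_top_mem] by simp
    then have "\<top>\<^bsub>M\<^esub> \<sqsubseteq>\<^bsub>M\<^esub> copair (res_prod I L)"
      using M.le_trans copair_upper[OF C_ideal_res_prod res_top_mem] tuple_meet_closed[OF res_top_mem]
        copair_closed[OF C_ideal_res_prod] M.top_closed by blast
    then show ?thesis using M.top_le_eq copair_closed[OF C_ideal_res_prod] by (simp add: coprod_top)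
  qed
  have meet: "copair (U \<sqinter>\<^bsub>frame_coprod I L\<^esub> V) = copair U \<sqinter>\<^bsub>M\<^esub> copair V"
    if U: "C_ideal I L U" and V: "C_ideal I L V" for U V
  proof -
    \<comment> \<open>Downsets turn pairs of tuples into single tuples: the meet of
      \<open>u \<in> U\<close> and \<open>v \<in> V\<close> is in both ideals, and conversely a
      common tuple is its own meet with itself. Distributivity of two joins in \<open>M\<close> then
      finishes the case.\<close>
    have "tuple_meet ` (U \<inter> V) =
        {a \<sqinter>\<^bsub>M\<^esub> b | a b. a \<in> tuple_meet ` U \<and> b \<in> tuple_meet ` V}" (is "_ = ?R")
    proof
      show "tuple_meet ` (U \<inter> V) \<subseteq> ?R"
      proof
        fix x assume "x \<in> tuple_meet ` (U \<inter> V)"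
        then obtain u where u: "u \<in> U" "u \<in> V" "x = tuple_meet u" by auto
        then have "u \<in> res_prod I L" using C_ideal_subset[OF U] by auto
        then have "x = tuple_meet u \<sqinter>\<^bsub>M\<^esub> tuple_meet u"
          using u(3) by (simp add: M.meet_absorb tuple_meet_closed)
        then show "x \<in> ?R" using u by blast
      qed
      show "?R \<subseteq> tuple_meet ` (U \<inter> V)"
      proof
        fix x assume "x \<in> ?R"
        then obtain u v where uv: "u \<in> U" "v \<in> V" "x = tuple_meet u \<sqinter>\<^bsub>M\<^esub> tuple_meet v" by auto
        then have "x = tuple_meet (res_meet u v)"
          using tuple_meet_res_meet[OF subsetD[OF C_ideal_subset[OF U]] subsetD[OF C_ideal_subset[OF V]]]
          by simp
        then show "x \<in> tuple_meet ` (U \<inter> V)" using C_ideal_res_meet[OF U V uv(1,2)] by blast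
      qed
    qed
    then show ?thesis
      using U V C_ideal_Int[OF U V] M.sup_meet_sup[OF tuple_meet_image[OF U] tuple_meet_image[OF V]]
      by (simp add: coprod_meet copair_eq)
  qed
  have sup: "copair (\<Squnion>\<^bsub>frame_coprod I L\<^esub> \<A>) = \<Squnion>\<^bsub>M\<^esub> (copair ` \<A>)"
    if A: "\<And>J. J \<in> \<A> \<Longrightarrow> C_ideal I L J" for \<A>
  proof -
    let ?S = "\<Squnion>\<^bsub>frame_coprod I L\<^esub> \<A>"
    have S: "C_ideal I L ?S" using A by (rule coprod_sup(1))
    have cA: "copair ` \<A> \<subseteq> carrier M" using A copair_closed by auto
    let ?y = "\<Squnion>\<^bsub>M\<^esub> (copair ` \<A>)"
    have y: "?y \<in> carrier M" using cA by simp
    \<comment> \<open>The join may contain tuples that lie in no member of \<open>\<A>\<close>. They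
      are controlled by enclosing the join in the C-ideal that the adjunction assigns to
      \<open>?y\<close>.\<close>
    have "?S \<subseteq> {u \<in> res_prod I L. tuple_meet u \<sqsubseteq>\<^bsub>M\<^esub> ?y}"
    proof (rule coprod_sup(3)[OF A C_ideal_tuple_meet_le[OF y]])
      fix J assume J: "J \<in> \<A>"
      have "tuple_meet u \<sqsubseteq>\<^bsub>M\<^esub> ?y" "u \<in> res_prod I L" if "u \<in> J" for u
      proof -
        show u: "u \<in> res_prod I L" using that C_ideal_subset[OF A[OF J]] by auto
        show "tuple_meet u \<sqsubseteq>\<^bsub>M\<^esub> ?y"
          using M.le_trans[OF copair_upper[OF A[OF J] that] M.sup_upper[OF cA]] J y
            tuple_meet_closed[OF u] copair_closed[OF A[OF J]] by simp
      qed
      then show "J \<subseteq> {u \<in> res_prod I L. tuple_meet u \<sqsubseteq>\<^bsub>M\<^esub> ?y}" by blast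
    qed
    then have 1: "copair ?S \<sqsubseteq>\<^bsub>M\<^esub> ?y" using copair_least[OF S y] by blast
    have 2: "?y \<sqsubseteq>\<^bsub>M\<^esub> copair ?S"
    proof (rule M.sup_least[OF cA copair_closed[OF S]])
      fix x assume "x \<in> copair ` \<A>"
      then obtain J where J: "J \<in> \<A>" "x = copair J" by auto
      then have "J \<subseteq> ?S" using coprod_sup(2)[OF A] by blast
      then show "x \<sqsubseteq>\<^bsub>M\<^esub> copair ?S"
        using J copair_least[OF A[OF J(1)] copair_closed[OF S]] copair_upper[OF S] by blast
    qed
    show ?thesis using M.le_antisym[OF 1 2 copair_closed[OF S] y] .
  qed
  have "copair \<in> extensional (carrier (frame_coprod I L))"
    unfolding copair_def by (rule restrict_extensional)
  moreover have "\<forall>A\<subseteq>carrier (frame_coprod I L). copair (\<Squnion>\<^bsub>frame_coprod I L\<^esub> A) = \<Squnion>\<^bsub>M\<^esub> (copair ` A)"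
    using sup by auto
  ultimately show ?thesis
    using top meet copair_closed by (simp add: frame_hom_def PiE_def)
qed

lemma copair_inj:
  assumes j: "j \<in> I" and a: "a \<in> carrier (L j)"
  shows "copair (coprod_inj j a) = f j a"
proof (rule M.le_antisym)
  interpret frame "L j" by (rule frames[OF j])
  note C = C_ideal_coprod_inj[OF j a]
  show "copair (coprod_inj j a) \<sqsubseteq>\<^bsub>M\<^esub> f j a"
  proof (rule copair_least[OF C f_carrier[OF j a]])
    fix u assume "u \<in> coprod_inj j a"
    then have u: "u \<in> res_prod I L" and "u j \<sqsubseteq>\<^bsub>L j\<^esub> a \<or> u \<in> null_ideal I L"
      using mem_coprod_inj[OF j a] by auto
    from this(2) show "tuple_meet u \<sqsubseteq>\<^bsub>M\<^esub> f j a"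
    proof
      assume "u j \<sqsubseteq>\<^bsub>L j\<^esub> a"
      then have "f j (u j) \<sqsubseteq>\<^bsub>M\<^esub> f j a"
        using frame_hom_mono[OF frames[OF j] M.frame_axioms f_hom[OF j]] res_carrier[OF u j] a by simp
      then show ?thesis
        using M.le_trans[OF tuple_meet_lower[OF u j]] tuple_meet_closed[OF u] f_carrier[OF j a]
          f_tuple_carrier[OF u j] by simp
    next
      assume "u \<in> null_ideal I L"
      then show ?thesis using f_carrier[OF j a] by (simp add: tuple_meet_null)
    qed
  qed
  \<comment> \<open>The bound is attained at the largest tuple with \<open>a\<close> at coordinate
    \<open>j\<close>, since the coordinates equal to \<open>\<top>\<close> do not lower the
    meet.\<close>
  have "(res_top I L)(j := a) \<in> coprod_inj j a"
    using res_upd[OF res_top_mem j a] a by (simp add: mem_coprod_inj[OF j a])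
  then show "f j a \<sqsubseteq>\<^bsub>M\<^esub> copair (coprod_inj j a)"
    using copair_upper[OF C] tuple_meet_top_upd[OF j a] by fastforce
qed (use j a in \<open>auto intro: copair_closed C_ideal_coprod_inj f_carrier\<close>)

text \<open>Each further coordinate in \<open>F\<close> intersects the cylinder with the image of
  one injection. As \<open>h\<close> respects \<open>\<top>\<close> and binary meets, its value is
  determined by induction as long as \<open>F\<close> is finite.\<close>

lemma hom_cylinder:
  assumes h: "h \<in> frame_hom (frame_coprod I L) M"
    and hf: "\<And>j a. \<lbrakk>j \<in> I; a \<in> carrier (L j)\<rbrakk> \<Longrightarrow> h (coprod_inj j a) = f j a"
    and u: "u \<in> res_prod I L"
    and F: "finite F" "F \<subseteq> I"
  shows "h (cylinder F u) = \<Sqinter>\<^bsub>M\<^esub> ((\<lambda>i. f i (u i)) ` F)"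
  using F
proof (induction F)
  case empty
  have "\<Sqinter>\<^bsub>M\<^esub> {} = \<top>\<^bsub>M\<^esub>" using M.weak_inf_empty by (simp add: M.eq_is_equal)
  then show ?case using frame_homD(3)[OF h] by (simp add: cylinder_empty coprod_top)
next
  case (insert j F)
  then have j: "j \<in> I" and F: "F \<subseteq> I" by auto
  note uj = res_carrier[OF u j]
  have CF: "C_ideal I L (cylinder F u)" using F res_carrier[OF u] by (intro C_ideal_cylinder) auto
  note Cj = C_ideal_coprod_inj[OF j uj]
  have "cylinder (insert j F) u = coprod_inj j (u j) \<sqinter>\<^bsub>frame_coprod I L\<^esub> cylinder F u"
    unfolding cylinder_insert[of j F u] using coprod_meet[OF Cj CF] coprod_inj_eq[OF j uj] by simp
  then have "h (cylinder (insert j F) u) = f j (u j) \<sqinter>\<^bsub>M\<^esub> \<Sqinter>\<^bsub>M\<^esub> ((\<lambda>i. f i (u i)) ` F)"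
    using frame_homD(4)[OF h] Cj CF hf[OF j uj] insert.IH[OF F] by simp
  also have "\<dots> = \<Sqinter>\<^bsub>M\<^esub> ((\<lambda>i. f i (u i)) ` insert j F)"
  proof -
    have "(\<lambda>i. f i (u i)) ` F \<subseteq> carrier M" using f_tuple_carrier[OF u] F by auto
    then show ?thesis
      using M.weak_inf_insert[OF f_tuple_carrier[OF u j]] by (simp add: M.eq_is_equal)
  qed
  finally show ?case .
qed

lemma hom_principal:
  assumes h: "h \<in> frame_hom (frame_coprod I L) M"
    and hf: "\<And>j a. \<lbrakk>j \<in> I; a \<in> carrier (L j)\<rbrakk> \<Longrightarrow> h (coprod_inj j a) = f j a"
    and u: "u \<in> res_prod I L"
  shows "h (cylinder I u) = tuple_meet u"
proof -
  \<comment> \<open>Outside the support of \<open>u\<close> the constraint is vacuous, so the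
    principal ideal of \<open>u\<close> is a cylinder over a finite set. Finite support of tuples is
    thus exactly what uniqueness requires.\<close>
  let ?F = "{i \<in> I. u i \<noteq> \<top>\<^bsub>L i\<^esub>}"
  have F: "finite ?F" using u by (simp add: res_prod_def)
  have "v i \<sqsubseteq>\<^bsub>L i\<^esub> u i" if "v \<in> res_prod I L" "i \<in> I" "i \<notin> ?F" for v i
  proof -
    interpret frame "L i" by (rule frames[OF that(2)])
    show ?thesis using res_carrier[OF that(1,2)] that by simp
  qed
  then have "cylinder I u = cylinder ?F u" by (auto simp: cylinder_def)
  then have "h (cylinder I u) = \<Sqinter>\<^bsub>M\<^esub> ((\<lambda>i. f i (u i)) ` ?F)"
    using hom_cylinder[OF h hf u F] by simp
  also have "\<dots> = tuple_meet u"
  proof (rule M.le_antisym)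
    have sub: "(\<lambda>i. f i (u i)) ` ?F \<subseteq> carrier M" using f_tuple_carrier[OF u] by auto
    then show c: "\<Sqinter>\<^bsub>M\<^esub> ((\<lambda>i. f i (u i)) ` ?F) \<in> carrier M" by simp
    show "tuple_meet u \<in> carrier M" using tuple_meet_closed[OF u] .
    show "\<Sqinter>\<^bsub>M\<^esub> ((\<lambda>i. f i (u i)) ` ?F) \<sqsubseteq>\<^bsub>M\<^esub> tuple_meet u"
    proof (rule tuple_meet_greatest[OF u c])
      fix i assume i: "i \<in> I"
      show "\<Sqinter>\<^bsub>M\<^esub> ((\<lambda>i. f i (u i)) ` ?F) \<sqsubseteq>\<^bsub>M\<^esub> f i (u i)"
      proof (cases "i \<in> ?F")
        case True then show ?thesis by (intro M.inf_lower[OF sub]) auto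
      next
        case False
        then show ?thesis using frame_homD(3)[OF f_hom[OF i]] i c by simp
      qed
    qed
    show "tuple_meet u \<sqsubseteq>\<^bsub>M\<^esub> \<Sqinter>\<^bsub>M\<^esub> ((\<lambda>i. f i (u i)) ` ?F)"
      by (rule M.inf_greatest[OF sub tuple_meet_closed[OF u]]) (use tuple_meet_lower[OF u] in auto)
  qed
  finally show ?thesis .
qed

text \<open>Every C-ideal is the join of the principal ideals of its tuples, and on a principal
  ideal the value of \<open>h\<close> is already forced.\<close>

lemma copair_unique:
  assumes h: "h \<in> frame_hom (frame_coprod I L) M"
    and hf: "\<And>j a. \<lbrakk>j \<in> I; a \<in> carrier (L j)\<rbrakk> \<Longrightarrow> h (coprod_inj j a) = f j a"
  shows "h = copair"
proof (rule extensionalityI)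
  show "h \<in> extensional (carrier (frame_coprod I L))"
    "copair \<in> extensional (carrier (frame_coprod I L))"
    using frame_homD(1)[OF h] frame_homD(1)[OF copair_hom] by auto
  fix U assume "U \<in> carrier (frame_coprod I L)"
  then have U: "C_ideal I L U" by simp
  have Us: "u \<in> res_prod I L" if "u \<in> U" for u using that C_ideal_subset[OF U] by auto
  have P: "C_ideal I L J" if "J \<in> cylinder I ` U" for J
    using that Us res_carrier by (auto intro!: C_ideal_cylinder)
  have "U = \<Squnion>\<^bsub>frame_coprod I L\<^esub> (cylinder I ` U)"
  proof
    show "U \<subseteq> \<Squnion>\<^bsub>frame_coprod I L\<^esub> (cylinder I ` U)"
      using coprod_sup(2)[OF P] mem_principal Us by blast
    show "\<Squnion>\<^bsub>frame_coprod I L\<^esub> (cylinder I ` U) \<subseteq> U"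
      by (rule coprod_sup(3)[OF P U]) (use principal_subset[OF U] in auto)
  qed
  then have "h U = \<Squnion>\<^bsub>M\<^esub> (h ` cylinder I ` U)"
    using frame_homD(5)[OF h, of "cylinder I ` U"] P by auto
  also have "h ` cylinder I ` U = tuple_meet ` U"
    using hom_principal[OF h hf] Us by (simp add: image_image)
  finally show "h U = copair U" using copair_eq[OF U] by simp
qed

end


section \<open>The coproduct of d-frames\<close>

text \<open>By a cover, \<open>v\<close> lies in \<open>J\<close> as soon as its restrictions to the two sides of one disjunction
  do. Doing this for every \<open>q \<in> Q\<close> is the distributive law for finite meets of joins.\<close>

lemma (in frame_family) C_ideal_split:
  assumes J: "C_ideal I L J" and Q: "finite Q" and v: "v \<in> res_prod I L"
    and xy: "\<And>q j. \<lbrakk>q \<in> Q; j \<in> I\<rbrakk> \<Longrightarrow> x q j \<in> carrier (L j) \<and> y q j \<in> carrier (L j)"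
    and le: "\<And>q. q \<in> Q \<Longrightarrow> \<exists>j\<in>I. v j \<sqsubseteq>\<^bsub>L j\<^esub> x q j \<squnion>\<^bsub>L j\<^esub> y q j"
    and mem: "\<And>w. \<lbrakk>w \<in> res_prod I L; res_le I L w v;
       \<And>q. q \<in> Q \<Longrightarrow> (\<exists>j\<in>I. w j \<sqsubseteq>\<^bsub>L j\<^esub> x q j) \<or> (\<exists>j\<in>I. w j \<sqsubseteq>\<^bsub>L j\<^esub> y q j)\<rbrakk> \<Longrightarrow> w \<in> J"
  shows "v \<in> J"
  using Q v xy le mem
proof (induction Q arbitrary: v)
  case empty
  then show ?case using res_le_refl[of v] by blast
next
  case (insert q Q)
  note v = insert.prems(1) and mem = insert.prems(4)
  obtain j where j: "j \<in> I" and le: "v j \<sqsubseteq>\<^bsub>L j\<^esub> x q j \<squnion>\<^bsub>L j\<^esub> y q j" using insert.prems(3) by blast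
  interpret frame "L j" by (rule frames[OF j])
  have x: "x q j \<in> carrier (L j)" and y: "y q j \<in> carrier (L j)" using insert.prems(2) j by auto
  note vj = res_carrier[OF v j]
  \<comment> \<open>The induction hypothesis is applied to the tuple cut down at \<open>j\<close>,
    not to \<open>v\<close>, which is why the induction generalises over \<open>v\<close>. The other
    alternatives survive the cut because they are inherited by smaller tuples.\<close>
  have part: "v(j := v j \<sqinter>\<^bsub>L j\<^esub> z) \<in> J" if z: "z \<in> {x q j, y q j}" for z
  proof -
    have zc: "z \<in> carrier (L j)" using z x y by auto
    let ?v = "v(j := v j \<sqinter>\<^bsub>L j\<^esub> z)"
    have v': "?v \<in> res_prod I L" using res_upd[OF v j] vj zc by simp
    have vle: "res_le I L ?v v"
      using res_le_refl[OF v] meet_left[OF vj zc] by (auto simp: res_le_def)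
    have below: "w i \<sqsubseteq>\<^bsub>L i\<^esub> b" if w: "w \<in> res_prod I L" "w i \<sqsubseteq>\<^bsub>L i\<^esub> c" "c \<sqsubseteq>\<^bsub>L i\<^esub> b"
      and i: "i \<in> I" and cb: "c \<in> carrier (L i)" "b \<in> carrier (L i)" for w i b c
    proof -
      interpret Li: frame "L i" by (rule frames[OF i])
      show ?thesis using Li.le_trans[OF w(2,3)] cb res_carrier[OF w(1) i] by simp
    qed
    have join: "x r i \<squnion>\<^bsub>L i\<^esub> y r i \<in> carrier (L i)" if "r \<in> Q" "i \<in> I" for r i
    proof -
      interpret Li: frame "L i" by (rule frames[OF that(2)])
      show ?thesis using insert.prems(2) that by simp
    qed
    show ?thesis
    proof (rule insert.IH[OF v'])
      show "x r i \<in> carrier (L i) \<and> y r i \<in> carrier (L i)" if "r \<in> Q" "i \<in> I" for r i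
        using insert.prems(2) that by simp
      show "\<exists>i\<in>I. ?v i \<sqsubseteq>\<^bsub>L i\<^esub> x r i \<squnion>\<^bsub>L i\<^esub> y r i" if r: "r \<in> Q" for r
      proof -
        obtain i where i: "i \<in> I" "v i \<sqsubseteq>\<^bsub>L i\<^esub> x r i \<squnion>\<^bsub>L i\<^esub> y r i" using insert.prems(3) r by blast
        have "?v i \<sqsubseteq>\<^bsub>L i\<^esub> v i" using vle i(1) by (simp add: res_le_def)
        then have "?v i \<sqsubseteq>\<^bsub>L i\<^esub> x r i \<squnion>\<^bsub>L i\<^esub> y r i"
          using below[OF v' _ i(2,1) res_carrier[OF v i(1)] join[OF r i(1)]] by simp
        then show ?thesis using i(1) by blast
      qed
      fix w
      assume w: "w \<in> res_prod I L" "res_le I L w ?v"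
        and wQ: "\<And>r. r \<in> Q \<Longrightarrow> (\<exists>i\<in>I. w i \<sqsubseteq>\<^bsub>L i\<^esub> x r i) \<or> (\<exists>i\<in>I. w i \<sqsubseteq>\<^bsub>L i\<^esub> y r i)"
      have "w j \<sqsubseteq>\<^bsub>L j\<^esub> v j \<sqinter>\<^bsub>L j\<^esub> z" using w(2) j by (auto simp: res_le_def)
      then have "w j \<sqsubseteq>\<^bsub>L j\<^esub> z" using below[OF w(1) _ meet_right[OF vj zc] j] vj zc by simp
      then have wq: "(\<exists>i\<in>I. w i \<sqsubseteq>\<^bsub>L i\<^esub> x q i) \<or> (\<exists>i\<in>I. w i \<sqsubseteq>\<^bsub>L i\<^esub> y q i)"
        using z j by auto
      show "w \<in> J"
      proof (rule mem[OF w(1) res_le_trans[OF w(1) v' v w(2) vle]])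
        fix r assume "r \<in> insert q Q"
        then show "(\<exists>i\<in>I. w i \<sqsubseteq>\<^bsub>L i\<^esub> x r i) \<or> (\<exists>i\<in>I. w i \<sqsubseteq>\<^bsub>L i\<^esub> y r i)"
          using wq wQ[of r] by (cases "r = q") auto
      qed
    qed
  qed
  have "v(j := \<Squnion>\<^bsub>L j\<^esub> ((\<lambda>z. v j \<sqinter>\<^bsub>L j\<^esub> z) ` {x q j, y q j})) \<in> J"
    by (rule C_ideal_cover[OF J j _ v]) (use vj x y part in auto)
  moreover have "\<Squnion>\<^bsub>L j\<^esub> ((\<lambda>z. v j \<sqinter>\<^bsub>L j\<^esub> z) ` {x q j, y q j}) = v j"
    by (rule sup_meet_eq) (use vj x y le in \<open>auto simp: join_def\<close>)
  ultimately show ?case by simp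
qed

section \<open>D-frames, their duals, and joins inside con\<close>

lemma is_dframeD:
  assumes "is_dframe \<L>"
  shows "frame (pos \<L>)" "frame (neg \<L>)"
    and "con \<L> \<subseteq> carrier (pos \<L>) \<times> carrier (neg \<L>)"
    and "tot \<L> \<subseteq> carrier (pos \<L>) \<times> carrier (neg \<L>)"
    and "info_down_closed (pos \<L>) (neg \<L>) (con \<L>)"
    and "info_up_closed (pos \<L>) (neg \<L>) (tot \<L>)"
    and "tt (pos \<L>) (neg \<L>) \<in> con \<L>" "tt (pos \<L>) (neg \<L>) \<in> tot \<L>"
    and "ff (pos \<L>) (neg \<L>) \<in> con \<L>" "ff (pos \<L>) (neg \<L>) \<in> tot \<L>"
    and "log_closed (pos \<L>) (neg \<L>) (con \<L>)"
    and "log_closed (pos \<L>) (neg \<L>) (tot \<L>)"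
    and "directed_join_closed (pos \<L>) (neg \<L>) (con \<L>)"
    and "\<lbrakk>\<alpha> \<in> con \<L>; \<beta> \<in> tot \<L>; fst \<alpha> = fst \<beta> \<or> snd \<alpha> = snd \<beta>\<rbrakk>
           \<Longrightarrow> info_le (pos \<L>) (neg \<L>) \<alpha> \<beta>"
  using assms unfolding is_dframe_def by blast+

text \<open>Converse exchanges the components of every pair. It respects the information order,
  while it interchanges \<open>tt\<close> with \<open>ff\<close> and \<open>log_and\<close> with
  \<open>log_or\<close>; since the axioms always require both members of such a couple, they are
  self-dual.\<close>

definition dframe_dual :: "('a, 'b) dframe \<Rightarrow> ('b, 'a) dframe" where
  "dframe_dual \<L> = \<lparr>pos = neg \<L>, neg = pos \<L>, con = (con \<L>)\<inverse>, tot = (tot \<L>)\<inverse>\<rparr>"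

lemma dframe_dual_simps [simp]:
  "pos (dframe_dual \<L>) = neg \<L>" "neg (dframe_dual \<L>) = pos \<L>"
  "con (dframe_dual \<L>) = (con \<L>)\<inverse>" "tot (dframe_dual \<L>) = (tot \<L>)\<inverse>"
  by (simp_all add: dframe_dual_def)

lemma info_down_closed_converse:
  "info_down_closed P N X \<Longrightarrow> info_down_closed N P (X\<inverse>)"
  by (auto simp: info_down_closed_def info_le_def)

lemma info_up_closed_converse:
  "info_up_closed P N X \<Longrightarrow> info_up_closed N P (X\<inverse>)"
  by (auto simp: info_up_closed_def info_le_def)

lemma log_closed_converse: "log_closed P N X \<Longrightarrow> log_closed N P (X\<inverse>)"
  unfolding log_closed_def
  by (intro ballI) (fastforce simp: log_and_def log_or_def)

lemma directed_join_closed_converse: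
  assumes "directed_join_closed P N X"
  shows "directed_join_closed N P (X\<inverse>)"
  unfolding directed_join_closed_def
proof (intro allI impI)
  fix D assume D: "D \<subseteq> X\<inverse>" "info_directed N P D"
  have "info_directed P N (D\<inverse>)"
    unfolding info_directed_def
  proof (intro conjI ballI)
    show "D\<inverse> \<noteq> {}" using D(2) by (auto simp: info_directed_def)
    fix \<alpha> \<beta> assume "\<alpha> \<in> D\<inverse>" "\<beta> \<in> D\<inverse>"
    then have "prod.swap \<alpha> \<in> D" "prod.swap \<beta> \<in> D" by auto
    then obtain \<gamma> where \<gamma>: "\<gamma> \<in> D" "info_le N P (prod.swap \<alpha>) \<gamma>" "info_le N P (prod.swap \<beta>) \<gamma>"
      using D(2) unfolding info_directed_def by blast
    then have "prod.swap \<gamma> \<in> D\<inverse>" "info_le P N \<alpha> (prod.swap \<gamma>)" "info_le P N \<beta> (prod.swap \<gamma>)"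
      by (simp_all add: info_le_def prod.swap_def)
    then show "\<exists>\<gamma>\<in>D\<inverse>. info_le P N \<alpha> \<gamma> \<and> info_le P N \<beta> \<gamma>"
      by (intro bexI conjI)
  qed
  moreover have "D\<inverse> \<subseteq> X" using D(1) by auto
  ultimately have "(\<Squnion>\<^bsub>P\<^esub> (fst ` (D\<inverse>)), \<Squnion>\<^bsub>N\<^esub> (snd ` (D\<inverse>))) \<in> X"
    using assms by (simp add: directed_join_closed_def)
  moreover have "fst ` (D\<inverse>) = snd ` D" "snd ` (D\<inverse>) = fst ` D" by force+
  ultimately show "(\<Squnion>\<^bsub>N\<^esub> (fst ` D), \<Squnion>\<^bsub>P\<^esub> (snd ` D)) \<in> X\<inverse>" by simp
qed

lemma is_dframe_dual:
  assumes "is_dframe \<L>" shows "is_dframe (dframe_dual \<L>)"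
proof -
  note d = is_dframeD[OF assms]
  have "info_le (neg \<L>) (pos \<L>) \<alpha> \<beta>"
    if "\<alpha> \<in> (con \<L>)\<inverse>" "\<beta> \<in> (tot \<L>)\<inverse>" "fst \<alpha> = fst \<beta> \<or> snd \<alpha> = snd \<beta>" for \<alpha> \<beta>
    using that d(14)[of "(snd \<alpha>, fst \<alpha>)" "(snd \<beta>, fst \<beta>)"] by (auto simp: info_le_def)
  then show ?thesis
    unfolding is_dframe_def
    using d(1-4,7-10) info_down_closed_converse[OF d(5)] info_up_closed_converse[OF d(6)]
      log_closed_converse[OF d(11)] log_closed_converse[OF d(12)]
      directed_join_closed_converse[OF d(13)]
    by (auto simp: tt_def ff_def)
qed

text \<open>With the first component fixed, closure under directed joins extends to arbitrary joins:
  the logical meet of two pairs with first component \<open>x\<close> joins their second components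
  and keeps \<open>x\<close>, because \<open>x \<sqinter> x = x\<close>.\<close>

lemma con_sup_snd:
  assumes "is_dframe \<L>" and x: "x \<in> carrier (pos \<L>)" and B: "B \<subseteq> carrier (neg \<L>)"
    and con: "\<And>b. b \<in> B \<Longrightarrow> (x, b) \<in> con \<L>"
  shows "(x, \<Squnion>\<^bsub>neg \<L>\<^esub> B) \<in> con \<L>"
proof -
  note d = is_dframeD[OF assms(1)]
  interpret P: frame "pos \<L>" by (rule d(1))
  interpret N: frame "neg \<L>" by (rule d(2))
  let ?s = "\<Squnion>\<^bsub>neg \<L>\<^esub> B"
  have s: "?s \<in> carrier (neg \<L>)" using B by simp
  \<comment> \<open>\<open>B\<close> need not be directed, so \<open>D\<close> collects all partners
    of \<open>x\<close> below the join of \<open>B\<close>; these are closed under binary joins. The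
    pair with \<open>\<bottom>\<close>, which lies below \<open>tt\<close>, keeps \<open>D\<close>
    nonempty even for empty \<open>B\<close>.\<close>
  define D where "D = {(x, b) | b. b \<in> carrier (neg \<L>) \<and> (x, b) \<in> con \<L> \<and> b \<sqsubseteq>\<^bsub>neg \<L>\<^esub> ?s}"
  have bot: "(x, \<bottom>\<^bsub>neg \<L>\<^esub>) \<in> con \<L>"
    using d(5,7) x by (auto simp: info_down_closed_def info_le_def tt_def)
  have join: "(x, b \<squnion>\<^bsub>neg \<L>\<^esub> c) \<in> con \<L>" if "(x, b) \<in> con \<L>" "(x, c) \<in> con \<L>" for b c
  proof -
    have "log_and (pos \<L>) (neg \<L>) (x, b) (x, c) \<in> con \<L>" using d(11) that by (simp add: log_closed_def)
    then show ?thesis using x by (simp add: log_and_def P.meet_absorb)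
  qed
  have "info_directed (pos \<L>) (neg \<L>) D"
    unfolding info_directed_def
  proof (intro conjI ballI)
    show "D \<noteq> {}" using bot s by (auto simp: D_def)
    fix \<alpha> \<beta> assume "\<alpha> \<in> D" "\<beta> \<in> D"
    then obtain b c where bc: "\<alpha> = (x, b)" "\<beta> = (x, c)" "(x, b) \<in> con \<L>" "(x, c) \<in> con \<L>"
      "b \<in> carrier (neg \<L>)" "c \<in> carrier (neg \<L>)" "b \<sqsubseteq>\<^bsub>neg \<L>\<^esub> ?s" "c \<sqsubseteq>\<^bsub>neg \<L>\<^esub> ?s"
      by (auto simp: D_def)
    have "(x, b \<squnion>\<^bsub>neg \<L>\<^esub> c) \<in> D" using bc join s by (simp add: D_def N.join_le)
    moreover have "info_le (pos \<L>) (neg \<L>) \<alpha> (x, b \<squnion>\<^bsub>neg \<L>\<^esub> c)"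
      "info_le (pos \<L>) (neg \<L>) \<beta> (x, b \<squnion>\<^bsub>neg \<L>\<^esub> c)"
      using bc x by (simp_all add: info_le_def N.join_left N.join_right)
    ultimately show "\<exists>\<gamma>\<in>D. info_le (pos \<L>) (neg \<L>) \<alpha> \<gamma> \<and> info_le (pos \<L>) (neg \<L>) \<beta> \<gamma>" by blast
  qed
  moreover have "D \<subseteq> con \<L>" by (auto simp: D_def)
  ultimately have "(\<Squnion>\<^bsub>pos \<L>\<^esub> (fst ` D), \<Squnion>\<^bsub>neg \<L>\<^esub> (snd ` D)) \<in> con \<L>"
    using d(13) by (simp add: directed_join_closed_def)
  moreover have "fst ` D = {x}" 
  proof -
    have "(x, \<bottom>\<^bsub>neg \<L>\<^esub>) \<in> D" using bot s by (simp add: D_def)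
    then have "x \<in> fst ` D" by (rule image_eqI[rotated]) simp
    moreover have "fst ` D \<subseteq> {x}" by (auto simp: D_def)
    ultimately show ?thesis by blast
  qed
  moreover have "\<Squnion>\<^bsub>neg \<L>\<^esub> (snd ` D) = ?s"
  proof (rule N.le_antisym)
    have sD: "snd ` D \<subseteq> carrier (neg \<L>)" by (auto simp: D_def)
    then show "\<Squnion>\<^bsub>neg \<L>\<^esub> (snd ` D) \<in> carrier (neg \<L>)" by simp
    show "\<Squnion>\<^bsub>neg \<L>\<^esub> (snd ` D) \<sqsubseteq>\<^bsub>neg \<L>\<^esub> ?s"
      by (rule N.sup_least[OF sD s]) (auto simp: D_def)
    show "?s \<sqsubseteq>\<^bsub>neg \<L>\<^esub> \<Squnion>\<^bsub>neg \<L>\<^esub> (snd ` D)"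
    proof (rule N.sup_least[OF B])
      fix b assume b: "b \<in> B"
      then have "(x, b) \<in> D" using con B N.sup_upper[OF B b] by (auto simp: D_def)
      then have "b \<in> snd ` D" by (rule image_eqI[rotated]) simp
      then show "b \<sqsubseteq>\<^bsub>neg \<L>\<^esub> \<Squnion>\<^bsub>neg \<L>\<^esub> (snd ` D)" by (rule N.sup_upper[OF sD])
    qed (use sD in simp)
  qed (rule s)
  ultimately show ?thesis using x by simp
qed

section \<open>Consistency of tuples and the bound for \<open>Con_star\<close>\<close>

locale dframe_family =
  fixes I :: "'i set" and \<L> :: "'i \<Rightarrow> ('a, 'b) dframe"
  assumes dframes: "i \<in> I \<Longrightarrow> is_dframe (\<L> i)"

sublocale dframe_family \<subseteq> P: frame_family I "\<lambda>i. pos (\<L> i)"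
  by (rule frame_family.intro) (rule is_dframeD(1)[OF dframes])

sublocale dframe_family \<subseteq> N: frame_family I "\<lambda>i. neg (\<L> i)"
  by (rule frame_family.intro) (rule is_dframeD(2)[OF dframes])

context dframe_family
begin

lemma dual_family: "dframe_family I (\<lambda>i. dframe_dual (\<L> i))"
  by (rule dframe_family.intro) (rule is_dframe_dual[OF dframes])

lemma inj_pos_eq: "inj_pos I \<L> j = P.coprod_inj j"
  by (simp add: inj_pos_def P.coprod_inj_def)

lemma inj_neg_eq: "inj_neg I \<L> j = N.coprod_inj j"
  by (simp add: inj_neg_def N.coprod_inj_def)

lemma coprod_pos_simps [simp]:
  "carrier (coprod_pos I \<L>) = {J. C_ideal I (\<lambda>i. pos (\<L> i)) J}"
  "le (coprod_pos I \<L>) = (\<subseteq>)"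
  by (simp_all add: coprod_pos_def)

lemma coprod_neg_simps [simp]:
  "carrier (coprod_neg I \<L>) = {J. C_ideal I (\<lambda>i. neg (\<L> i)) J}"
  "le (coprod_neg I \<L>) = (\<subseteq>)"
  by (simp_all add: coprod_neg_def)

lemma frame_coprod_pos: "frame (coprod_pos I \<L>)"
  by (simp add: coprod_pos_def P.coprod_frame)

lemma frame_coprod_neg: "frame (coprod_neg I \<L>)"
  by (simp add: coprod_neg_def N.coprod_frame)

lemma con_carrier: "\<lbrakk>j \<in> I; (a, b) \<in> con (\<L> j)\<rbrakk> \<Longrightarrow> a \<in> carrier (pos (\<L> j)) \<and> b \<in> carrier (neg (\<L> j))"
  using is_dframeD(3)[OF dframes] by blast

lemma tot_carrier: "\<lbrakk>j \<in> I; (a, b) \<in> tot (\<L> j)\<rbrakk> \<Longrightarrow> a \<in> carrier (pos (\<L> j)) \<and> b \<in> carrier (neg (\<L> j))"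
  using is_dframeD(4)[OF dframes] by blast

lemma con_down:
  assumes "j \<in> I" "(a, b) \<in> con (\<L> j)" "a' \<in> carrier (pos (\<L> j))" "b' \<in> carrier (neg (\<L> j))"
    and "a' \<sqsubseteq>\<^bsub>pos (\<L> j)\<^esub> a" "b' \<sqsubseteq>\<^bsub>neg (\<L> j)\<^esub> b"
  shows "(a', b') \<in> con (\<L> j)"
  using is_dframeD(5)[OF dframes[OF assms(1)]] assms(2-)
  unfolding info_down_closed_def info_le_def by fastforce

text \<open>If coordinate \<open>j\<close> witnesses the relation, then the principal ideals of
  \<open>u\<close> and \<open>v\<close> lie below the images of \<open>u j\<close> and
  \<open>v j\<close>, a pair in \<open>con1\<close>. The relation records what \<open>con1\<close>
  and downward closure impose on basic ideals.\<close>

definition con_rel :: "('i \<Rightarrow> 'a) \<Rightarrow> ('i \<Rightarrow> 'b) \<Rightarrow> bool" where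
  "con_rel u v \<longleftrightarrow> (\<exists>j\<in>I. (u j, v j) \<in> con (\<L> j))"

text \<open>A cover varies one coordinate \<open>j\<close> only. A witness of consistency at another
  coordinate is unaffected; if there is none, every \<open>a \<in> A\<close> must be a partner of
  \<open>u j\<close> in con, and the partners of \<open>u j\<close> are closed under joins. The
  empty family is included.\<close>

lemma C_ideal_con_rel_snd:
  assumes u: "u \<in> res_prod I (\<lambda>i. pos (\<L> i))"
  shows "C_ideal I (\<lambda>i. neg (\<L> i)) {v \<in> res_prod I (\<lambda>i. neg (\<L> i)). con_rel u v}"
proof (rule N.C_idealI)
  fix v w
  assume v: "v \<in> {v \<in> res_prod I (\<lambda>i. neg (\<L> i)). con_rel u v}"
    and w: "w \<in> res_prod I (\<lambda>i. neg (\<L> i))" "res_le I (\<lambda>i. neg (\<L> i)) w v"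
  from v obtain j where j: "j \<in> I" "(u j, v j) \<in> con (\<L> j)" by (auto simp: con_rel_def)
  interpret Pj: frame "pos (\<L> j)" by (rule P.frames[OF j(1)])
  have "(u j, w j) \<in> con (\<L> j)"
    using con_down[OF j P.res_carrier[OF u j(1)] N.res_carrier[OF w(1) j(1)]]
      P.res_carrier[OF u j(1)] w(2) j(1) by (simp add: res_le_def)
  then show "w \<in> {v \<in> res_prod I (\<lambda>i. neg (\<L> i)). con_rel u v}"
    using w(1) j(1) by (auto simp: con_rel_def)
next
  fix j A v
  assume j: "j \<in> I" and A: "A \<subseteq> carrier (neg (\<L> j))" and v: "v \<in> res_prod I (\<lambda>i. neg (\<L> i))"
    and mem: "\<And>a. a \<in> A \<Longrightarrow> v(j := a) \<in> {v \<in> res_prod I (\<lambda>i. neg (\<L> i)). con_rel u v}"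
  interpret Nj: frame "neg (\<L> j)" by (rule N.frames[OF j])
  have "con_rel u (v(j := \<Squnion>\<^bsub>neg (\<L> j)\<^esub> A))"
  proof (cases "\<exists>i\<in>I. i \<noteq> j \<and> (u i, v i) \<in> con (\<L> i)")
    case True then show ?thesis by (auto simp: con_rel_def)
  next
    case False
    have "(u j, a) \<in> con (\<L> j)" if a: "a \<in> A" for a
    proof -
      obtain i where i: "i \<in> I" "(u i, (v(j := a)) i) \<in> con (\<L> i)"
        using mem[OF a] by (auto simp: con_rel_def)
      then show ?thesis using False by (cases "i = j") auto
    qed
    then have "(u j, \<Squnion>\<^bsub>neg (\<L> j)\<^esub> A) \<in> con (\<L> j)"
      using con_sup_snd[OF dframes[OF j] P.res_carrier[OF u j] A] by blast
    then show ?thesis using j by (auto simp: con_rel_def)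
  qed
  then show "v(j := \<Squnion>\<^bsub>neg (\<L> j)\<^esub> A) \<in> {v \<in> res_prod I (\<lambda>i. neg (\<L> i)). con_rel u v}"
    using N.res_upd[OF v j] A by simp
qed auto

lemma C_ideal_con_rel_fst:
  assumes v: "v \<in> res_prod I (\<lambda>i. neg (\<L> i))"
  shows "C_ideal I (\<lambda>i. pos (\<L> i)) {u \<in> res_prod I (\<lambda>i. pos (\<L> i)). con_rel u v}"
proof -
  interpret D: dframe_family I "\<lambda>i. dframe_dual (\<L> i)" by (rule dual_family)
  have "D.con_rel v u \<longleftrightarrow> con_rel u v" for u by (simp add: D.con_rel_def con_rel_def)
  then show ?thesis using D.C_ideal_con_rel_snd[of v] v by simp
qed

text \<open>Null tuples belong to every C-ideal, in particular to the two defined by the relation.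
  In terms of coordinates, a pair with a component \<open>\<bottom>\<close> lies below
  \<open>tt\<close> or \<open>ff\<close>.\<close>

lemma con_rel_null:
  assumes u: "u \<in> res_prod I (\<lambda>i. pos (\<L> i))" and v: "v \<in> res_prod I (\<lambda>i. neg (\<L> i))"
    and "u \<in> null_ideal I (\<lambda>i. pos (\<L> i)) \<or> v \<in> null_ideal I (\<lambda>i. neg (\<L> i))"
  shows "con_rel u v"
  using assms(3) P.null_subset_C_ideal[OF C_ideal_con_rel_fst[OF v]]
    N.null_subset_C_ideal[OF C_ideal_con_rel_snd[OF u]] by blast

definition con_pairs :: "(('i \<Rightarrow> 'a) set \<times> ('i \<Rightarrow> 'b) set) set" where
  "con_pairs = {(U, V). C_ideal I (\<lambda>i. pos (\<L> i)) U \<and> C_ideal I (\<lambda>i. neg (\<L> i)) V \<and>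
     (\<forall>u\<in>U. \<forall>v\<in>V. con_rel u v)}"

text \<open>The relation is carried to the joins one variable at a time. For fixed \<open>u\<close>,
  the C-ideal of partners contains every member of \<open>\<B>\<close> and so their join; for a
  fixed \<open>v\<close> of that join, the same argument applies to \<open>\<A>\<close>.\<close>

lemma con_pairs_sup:
  assumes A: "\<And>U. U \<in> \<A> \<Longrightarrow> C_ideal I (\<lambda>i. pos (\<L> i)) U"
    and B: "\<And>V. V \<in> \<B> \<Longrightarrow> C_ideal I (\<lambda>i. neg (\<L> i)) V"
    and rel: "\<And>U V u v. \<lbrakk>U \<in> \<A>; V \<in> \<B>; u \<in> U; v \<in> V\<rbrakk> \<Longrightarrow> con_rel u v"
  shows "(\<Squnion>\<^bsub>coprod_pos I \<L>\<^esub> \<A>, \<Squnion>\<^bsub>coprod_neg I \<L>\<^esub> \<B>) \<in> con_pairs"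
proof -
  let ?S = "\<Squnion>\<^bsub>frame_coprod I (\<lambda>i. pos (\<L> i))\<^esub> \<A>" and ?T = "\<Squnion>\<^bsub>frame_coprod I (\<lambda>i. neg (\<L> i))\<^esub> \<B>"
  have S: "C_ideal I (\<lambda>i. pos (\<L> i)) ?S" using A by (rule P.coprod_sup(1))
  have T: "C_ideal I (\<lambda>i. neg (\<L> i)) ?T" using B by (rule N.coprod_sup(1))
  have 1: "con_rel u v" if u: "U \<in> \<A>" "u \<in> U" and v: "v \<in> ?T" for U u v
  proof -
    have uB: "u \<in> res_prod I (\<lambda>i. pos (\<L> i))" using P.C_ideal_subset[OF A[OF u(1)]] u(2) by auto
    have "?T \<subseteq> {v \<in> res_prod I (\<lambda>i. neg (\<L> i)). con_rel u v}"
    proof (rule N.coprod_sup(3)[OF B C_ideal_con_rel_snd[OF uB]])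
      fix V assume V: "V \<in> \<B>"
      show "V \<subseteq> {v \<in> res_prod I (\<lambda>i. neg (\<L> i)). con_rel u v}"
        using N.C_ideal_subset[OF B[OF V]] rel[OF u(1) V u(2)] by blast
    qed
    then show ?thesis using v by blast
  qed
  have "con_rel u v" if u: "u \<in> ?S" and v: "v \<in> ?T" for u v
  proof -
    have vB: "v \<in> res_prod I (\<lambda>i. neg (\<L> i))" using N.C_ideal_subset[OF T] v by auto
    have "?S \<subseteq> {u \<in> res_prod I (\<lambda>i. pos (\<L> i)). con_rel u v}"
    proof (rule P.coprod_sup(3)[OF A C_ideal_con_rel_fst[OF vB]])
      fix U assume U: "U \<in> \<A>"
      show "U \<subseteq> {u \<in> res_prod I (\<lambda>i. pos (\<L> i)). con_rel u v}"
        using P.C_ideal_subset[OF A[OF U]] 1[OF U _ v] by blast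
    qed
    then show ?thesis using u by blast
  qed
  then show ?thesis using S T by (simp add: con_pairs_def coprod_pos_def coprod_neg_def)
qed

lemma con1_subset: "con1 I \<L> \<subseteq> con_pairs"
proof
  fix \<alpha> assume "\<alpha> \<in> con1 I \<L>"
  then obtain j a b where j: "j \<in> I" and ab: "(a, b) \<in> con (\<L> j)"
    and \<alpha>: "\<alpha> = (P.coprod_inj j a, N.coprod_inj j b)"
    by (auto simp: con1_def inj_pos_eq inj_neg_eq)
  have a: "a \<in> carrier (pos (\<L> j))" and b: "b \<in> carrier (neg (\<L> j))"
    using con_carrier[OF j ab] by auto
  have "con_rel u v" if u: "u \<in> P.coprod_inj j a" and v: "v \<in> N.coprod_inj j b" for u v
  proof -
    have uB: "u \<in> res_prod I (\<lambda>i. pos (\<L> i))" and vB: "v \<in> res_prod I (\<lambda>i. neg (\<L> i))"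
      using u v by (auto simp: P.mem_coprod_inj[OF j a] N.mem_coprod_inj[OF j b])
    show ?thesis
    proof (cases "u \<in> null_ideal I (\<lambda>i. pos (\<L> i)) \<or> v \<in> null_ideal I (\<lambda>i. neg (\<L> i))")
      case True then show ?thesis by (rule con_rel_null[OF uB vB])
    next
      case False
      then have "u j \<sqsubseteq>\<^bsub>pos (\<L> j)\<^esub> a" "v j \<sqsubseteq>\<^bsub>neg (\<L> j)\<^esub> b"
        using u v by (auto simp: P.mem_coprod_inj[OF j a] N.mem_coprod_inj[OF j b])
      then have "(u j, v j) \<in> con (\<L> j)"
        using con_down[OF j ab P.res_carrier[OF uB j] N.res_carrier[OF vB j]] by simp
      then show ?thesis using j by (auto simp: con_rel_def)
    qed
  qed
  then show "\<alpha> \<in> con_pairs"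
    using \<alpha> P.C_ideal_coprod_inj[OF j a] N.C_ideal_coprod_inj[OF j b] by (simp add: con_pairs_def)
qed

lemma tt_con_pairs: "tt (coprod_pos I \<L>) (coprod_neg I \<L>) \<in> con_pairs"
  using con_rel_null P.C_ideal_res_prod N.C_ideal_null N.C_ideal_subset[OF N.C_ideal_null]
  by (auto simp: con_pairs_def tt_def coprod_pos_def coprod_neg_def P.coprod_top N.coprod_bottom)

lemma ff_con_pairs: "ff (coprod_pos I \<L>) (coprod_neg I \<L>) \<in> con_pairs"
  using con_rel_null N.C_ideal_res_prod P.C_ideal_null P.C_ideal_subset[OF P.C_ideal_null]
  by (auto simp: con_pairs_def ff_def coprod_pos_def coprod_neg_def N.coprod_top P.coprod_bottom)

lemma con_pairs_down: "info_down_closed (coprod_pos I \<L>) (coprod_neg I \<L>) con_pairs"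
  by (auto simp: info_down_closed_def con_pairs_def info_le_def)

lemma con_pairs_directed: "directed_join_closed (coprod_pos I \<L>) (coprod_neg I \<L>) con_pairs"
  unfolding directed_join_closed_def
proof (intro allI impI)
  fix D assume D: "D \<subseteq> con_pairs" and dir: "info_directed (coprod_pos I \<L>) (coprod_neg I \<L>) D"
  show "(\<Squnion>\<^bsub>coprod_pos I \<L>\<^esub> (fst ` D), \<Squnion>\<^bsub>coprod_neg I \<L>\<^esub> (snd ` D)) \<in> con_pairs"
  proof (rule con_pairs_sup)
    show "C_ideal I (\<lambda>i. pos (\<L> i)) U" if "U \<in> fst ` D" for U
      using that D by (auto simp: con_pairs_def)
    show "C_ideal I (\<lambda>i. neg (\<L> i)) V" if "V \<in> snd ` D" for V
      using that D by (auto simp: con_pairs_def)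
    fix U V u v assume "U \<in> fst ` D" "V \<in> snd ` D" and uv: "u \<in> U" "v \<in> V"
    then obtain \<alpha> \<beta> where ab: "\<alpha> \<in> D" "\<beta> \<in> D" "U = fst \<alpha>" "V = snd \<beta>" by auto
    \<comment> \<open>The tuples \<open>u\<close> and \<open>v\<close> come from different members
      of \<open>D\<close>; directedness supplies one member whose two components contain
      both.\<close>
    then obtain \<gamma> where c: "\<gamma> \<in> D" "info_le (coprod_pos I \<L>) (coprod_neg I \<L>) \<alpha> \<gamma>"
      "info_le (coprod_pos I \<L>) (coprod_neg I \<L>) \<beta> \<gamma>"
      using dir unfolding info_directed_def by blast
    have "u \<in> fst \<gamma>" "v \<in> snd \<gamma>" using c(2,3) ab(3,4) uv by (auto simp: info_le_def)
    moreover have "\<gamma> \<in> con_pairs" using D c(1) by blast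
    ultimately show "con_rel u v" by (simp add: con_pairs_def case_prod_beta)
  qed
qed

lemma con_pairs_log: "log_closed (coprod_pos I \<L>) (coprod_neg I \<L>) con_pairs"
  unfolding log_closed_def
proof (intro ballI)
  fix \<alpha> \<beta> assume ab: "\<alpha> \<in> con_pairs" "\<beta> \<in> con_pairs"
  obtain U V U' V' where eq: "\<alpha> = (U, V)" "\<beta> = (U', V')" by (cases \<alpha>, cases \<beta>) auto
  interpret FP: frame "coprod_pos I \<L>" by (rule frame_coprod_pos)
  interpret FN: frame "coprod_neg I \<L>" by (rule frame_coprod_neg)
  have id: "C_ideal I (\<lambda>i. pos (\<L> i)) U" "C_ideal I (\<lambda>i. pos (\<L> i)) U'"
    "C_ideal I (\<lambda>i. neg (\<L> i)) V" "C_ideal I (\<lambda>i. neg (\<L> i)) V'"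
    using ab eq by (auto simp: con_pairs_def)
  have rel: "\<And>u v. u \<in> U \<Longrightarrow> v \<in> V \<Longrightarrow> con_rel u v" "\<And>u v. u \<in> U' \<Longrightarrow> v \<in> V' \<Longrightarrow> con_rel u v"
    using ab eq by (auto simp: con_pairs_def)
  note idP = P.C_ideal_Int[OF id(1,2)] and idN = N.C_ideal_Int[OF id(3,4)]
  \<comment> \<open>Writing the meet as the join of a singleton lets the lemma on joins treat both
    components. A tuple in \<open>U \<inter> U'\<close> is related to the tuples of \<open>V\<close>
    as well as to those of \<open>V'\<close>.\<close>
  have "(\<Squnion>\<^bsub>coprod_pos I \<L>\<^esub> {U \<inter> U'}, \<Squnion>\<^bsub>coprod_neg I \<L>\<^esub> {V, V'}) \<in> con_pairs"
    by (rule con_pairs_sup) (use id idP rel in auto)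
  then have 1: "log_and (coprod_pos I \<L>) (coprod_neg I \<L>) \<alpha> \<beta> \<in> con_pairs"
    using eq idP P.coprod_meet[OF id(1,2)]
    by (simp add: log_and_def join_def flip: coprod_pos_def)
  have "(\<Squnion>\<^bsub>coprod_pos I \<L>\<^esub> {U, U'}, \<Squnion>\<^bsub>coprod_neg I \<L>\<^esub> {V \<inter> V'}) \<in> con_pairs"
    by (rule con_pairs_sup) (use id idN rel in auto)
  then have 2: "log_or (coprod_pos I \<L>) (coprod_neg I \<L>) \<alpha> \<beta> \<in> con_pairs"
    using eq idN N.coprod_meet[OF id(3,4)]
    by (simp add: log_or_def join_def flip: coprod_neg_def)
  show "log_and (coprod_pos I \<L>) (coprod_neg I \<L>) \<alpha> \<beta> \<in> con_pairs \<and>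
    log_or (coprod_pos I \<L>) (coprod_neg I \<L>) \<alpha> \<beta> \<in> con_pairs" using 1 2 ..
qed

lemma con_pairs_carrier: "con_pairs \<subseteq> carrier (coprod_pos I \<L>) \<times> carrier (coprod_neg I \<L>)"
  by (auto simp: con_pairs_def)

section \<open>Normal forms and the bound for \<open>Tot_star\<close>\<close>

definition tot_sections :: "('i \<Rightarrow> 'a \<times> 'b) set" where
  "tot_sections = {t. (\<forall>i\<in>I. t i \<in> tot (\<L> i)) \<and> (\<lambda>i\<in>I. fst (t i)) \<in> res_prod I (\<lambda>i. pos (\<L> i))}"

text \<open>For a section \<open>t\<close>, this is membership of \<open>v\<close> in the union over
  \<open>j\<close> of the ideals generated by \<open>snd (t j)\<close>. The union stands in for
  their join, the negative part of the logical meet of the images of the \<open>t j\<close>. On the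
  positive side the meet is the principal ideal of the tuple of first components.\<close>

definition below_section :: "('i \<Rightarrow> 'b) \<Rightarrow> ('i \<Rightarrow> 'a \<times> 'b) \<Rightarrow> bool" where
  "below_section v t \<longleftrightarrow> (\<exists>j\<in>I. v j \<sqsubseteq>\<^bsub>neg (\<L> j)\<^esub> snd (t j))"

text \<open>The finite set \<open>S\<close> is a disjunctive normal form: it stands for the logical join over
  \<open>t \<in> S\<close> of the logical meets over \<open>j\<close> of the images of the \<open>t j\<close>. The two last conditions say
  that this element lies below \<open>(U, V)\<close> in the information order.\<close>

definition tot_witness ::
  "('i \<Rightarrow> 'a \<times> 'b) set \<Rightarrow> ('i \<Rightarrow> 'a) set \<Rightarrow> ('i \<Rightarrow> 'b) set \<Rightarrow> bool" where
  "tot_witness S U V \<longleftrightarrow> finite S \<and> S \<subseteq> tot_sections \<and> (\<forall>t\<in>S. (\<lambda>i\<in>I. fst (t i)) \<in> U) \<and>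
     (\<forall>v\<in>res_prod I (\<lambda>i. neg (\<L> i)). (\<forall>t\<in>S. below_section v t) \<longrightarrow> v \<in> V)"

definition tot_pairs :: "(('i \<Rightarrow> 'a) set \<times> ('i \<Rightarrow> 'b) set) set" where
  "tot_pairs = {(U, V). C_ideal I (\<lambda>i. pos (\<L> i)) U \<and> C_ideal I (\<lambda>i. neg (\<L> i)) V \<and>
     (\<exists>S. tot_witness S U V)}"

lemma tot_witnessD:
  assumes "tot_witness S U V"
  shows "finite S" "S \<subseteq> tot_sections" "t \<in> S \<Longrightarrow> (\<lambda>i\<in>I. fst (t i)) \<in> U"
    and "\<lbrakk>v \<in> res_prod I (\<lambda>i. neg (\<L> i)); \<And>t. t \<in> S \<Longrightarrow> below_section v t\<rbrakk> \<Longrightarrow> v \<in> V"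
  using assms by (simp_all add: tot_witness_def)

lemma tot_pairsI:
  assumes "C_ideal I (\<lambda>i. pos (\<L> i)) U" "C_ideal I (\<lambda>i. neg (\<L> i)) V"
    and "finite S" "S \<subseteq> tot_sections" "\<And>t. t \<in> S \<Longrightarrow> (\<lambda>i\<in>I. fst (t i)) \<in> U"
    and "\<And>v. \<lbrakk>v \<in> res_prod I (\<lambda>i. neg (\<L> i)); \<And>t. t \<in> S \<Longrightarrow> below_section v t\<rbrakk> \<Longrightarrow> v \<in> V"
  shows "(U, V) \<in> tot_pairs"
proof -
  have "tot_witness S U V" using assms(3-6) by (simp add: tot_witness_def)
  then show ?thesis using assms(1,2) by (auto simp: tot_pairs_def)
qed

lemma tot_pairsE:
  assumes "(U, V) \<in> tot_pairs"
  obtains S where "tot_witness S U V" "C_ideal I (\<lambda>i. pos (\<L> i)) U" "C_ideal I (\<lambda>i. neg (\<L> i)) V"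
  using assms unfolding tot_pairs_def by blast

lemma tot_le_of_con:
  assumes j: "j \<in> I" and con: "(a, c) \<in> con (\<L> j)" and tot: "(a, b) \<in> tot (\<L> j)"
  shows "c \<sqsubseteq>\<^bsub>neg (\<L> j)\<^esub> b"
  using is_dframeD(14)[OF dframes[OF j] con tot] by (simp add: info_le_def)

text \<open>The first components of a clause \<open>t\<close> form a tuple of \<open>U\<close>, so
  con relates it to \<open>v\<close> at some coordinate \<open>j\<close>. There \<open>t j\<close>
  is in tot and has the same first component as a pair in con, and (con-tot) of
  \<open>\<L> j\<close> bounds \<open>v j\<close> by \<open>snd (t j)\<close>.\<close>

lemma con_pairs_tot_pairs:
  assumes con: "(U, V) \<in> con_pairs" and tot: "(U', V') \<in> tot_pairs" and sub: "U' \<subseteq> U"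
  shows "V \<subseteq> V'"
proof
  fix v assume v: "v \<in> V"
  obtain S where "tot_witness S U' V'" using tot by (rule tot_pairsE)
  note S = tot_witnessD[OF this]
  show "v \<in> V'"
  proof (rule S(4))
    show "v \<in> res_prod I (\<lambda>i. neg (\<L> i))"
      using con v N.C_ideal_subset by (auto simp: con_pairs_def)
    fix t assume t: "t \<in> S"
    then have "con_rel (\<lambda>i\<in>I. fst (t i)) v" using S(3)[OF t] sub con v by (auto simp: con_pairs_def)
    then obtain j where j: "j \<in> I" "(fst (t j), v j) \<in> con (\<L> j)" by (auto simp: con_rel_def)
    moreover have "(fst (t j), snd (t j)) \<in> tot (\<L> j)" using S(2) t j(1) by (auto simp: tot_sections_def)
    ultimately show "below_section v t" using tot_le_of_con j(1) unfolding below_section_def by blast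
  qed
qed

text \<open>A single pair becomes a section by filling the other coordinates with \<open>tt\<close>,
  the neutral element of the logical meet. Its first components form the tuple that generates the
  image of \<open>a\<close>.\<close>

lemma top_section:
  assumes "j \<in> I" "(a, b) \<in> tot (\<L> j)"
  shows "(\<lambda>i. tt (pos (\<L> i)) (neg (\<L> i)))(j := (a, b)) \<in> tot_sections"
    and "(\<lambda>i\<in>I. fst (((\<lambda>i. tt (pos (\<L> i)) (neg (\<L> i)))(j := (a, b))) i))
      = (res_top I (\<lambda>i. pos (\<L> i)))(j := a)"
proof -
  show eq: "(\<lambda>i\<in>I. fst (((\<lambda>i. tt (pos (\<L> i)) (neg (\<L> i)))(j := (a, b))) i))
      = (res_top I (\<lambda>i. pos (\<L> i)))(j := a)"
    using assms(1) by (auto simp: fun_eq_iff res_top_def tt_def)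
  have "(\<lambda>i\<in>I. fst (((\<lambda>i. tt (pos (\<L> i)) (neg (\<L> i)))(j := (a, b))) i))
      \<in> res_prod I (\<lambda>i. pos (\<L> i))"
    unfolding eq using P.res_upd[OF P.res_top_mem assms(1)] tot_carrier[OF assms] by blast
  then show "(\<lambda>i. tt (pos (\<L> i)) (neg (\<L> i)))(j := (a, b)) \<in> tot_sections"
    unfolding tot_sections_def using is_dframeD(8)[OF dframes] assms(2) by simp
qed

lemma le_bottom_null:
  assumes "v \<in> res_prod I (\<lambda>i. neg (\<L> i))" "i \<in> I" "v i \<sqsubseteq>\<^bsub>neg (\<L> i)\<^esub> \<bottom>\<^bsub>neg (\<L> i)\<^esub>"
  shows "v \<in> null_ideal I (\<lambda>i. neg (\<L> i))"
proof -
  have "v i = \<bottom>\<^bsub>neg (\<L> i)\<^esub>"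
    using frame.le_bottom_eq[OF N.frames[OF assms(2)] N.res_carrier[OF assms(1,2)] assms(3)] .
  then show ?thesis using assms(1,2) by (auto simp: null_ideal_def)
qed

lemma tot1_subset: "tot1 I \<L> \<subseteq> tot_pairs"
proof
  fix \<alpha> assume "\<alpha> \<in> tot1 I \<L>"
  then obtain j a b where j: "j \<in> I" and ab: "(a, b) \<in> tot (\<L> j)"
    and \<alpha>: "\<alpha> = (P.coprod_inj j a, N.coprod_inj j b)"
    by (auto simp: tot1_def inj_pos_eq inj_neg_eq)
  have a: "a \<in> carrier (pos (\<L> j))" and b: "b \<in> carrier (neg (\<L> j))"
    using tot_carrier[OF j ab] by auto
  interpret Pj: frame "pos (\<L> j)" by (rule P.frames[OF j])
  let ?t = "(\<lambda>i. tt (pos (\<L> i)) (neg (\<L> i)))(j := (a, b))"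
  show "\<alpha> \<in> tot_pairs"
    unfolding \<alpha>
  proof (rule tot_pairsI[where S = "{?t}"])
    show "C_ideal I (\<lambda>i. pos (\<L> i)) (P.coprod_inj j a)" by (rule P.C_ideal_coprod_inj[OF j a])
    show "C_ideal I (\<lambda>i. neg (\<L> i)) (N.coprod_inj j b)" by (rule N.C_ideal_coprod_inj[OF j b])
    show "{?t} \<subseteq> tot_sections" using top_section(1)[OF j ab] by simp
    have "(res_top I (\<lambda>i. pos (\<L> i)))(j := a) \<in> P.coprod_inj j a"
      using P.res_upd[OF P.res_top_mem j a] a by (simp add: P.mem_coprod_inj[OF j a])
    then show "(\<lambda>i\<in>I. fst (t i)) \<in> P.coprod_inj j a" if "t \<in> {?t}" for t
      using that top_section(2)[OF j ab] by simp
    fix v assume v: "v \<in> res_prod I (\<lambda>i. neg (\<L> i))" and "\<And>t. t \<in> {?t} \<Longrightarrow> below_section v t"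
    then obtain i where i: "i \<in> I" "v i \<sqsubseteq>\<^bsub>neg (\<L> i)\<^esub> snd (?t i)" unfolding below_section_def by blast
    show "v \<in> N.coprod_inj j b"
    proof (cases "i = j")
      case True then show ?thesis using i v by (simp add: N.mem_coprod_inj[OF j b])
    next
      case False
      \<comment> \<open>Away from \<open>j\<close> the section has second component
        \<open>\<bottom>\<close>, so a tuple below it there is null and lies in every
        C-ideal.\<close>
      then have "v \<in> null_ideal I (\<lambda>i. neg (\<L> i))" using le_bottom_null[OF v i(1)] i(2) by (simp add: tt_def)
      then show ?thesis using v by (simp add: N.mem_coprod_inj[OF j b])
    qed
  qed simp
qed

lemma tt_tot_pairs: "tt (coprod_pos I \<L>) (coprod_neg I \<L>) \<in> tot_pairs"
proof -
  let ?t = "\<lambda>i. tt (pos (\<L> i)) (neg (\<L> i))"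
  have t: "(\<lambda>i\<in>I. fst (?t i)) \<in> res_prod I (\<lambda>i. pos (\<L> i))"
    using P.res_top_mem by (simp add: res_top_def tt_def)
  have "(res_prod I (\<lambda>i. pos (\<L> i)), null_ideal I (\<lambda>i. neg (\<L> i))) \<in> tot_pairs"
  \<comment> \<open>One clause that is \<open>tt\<close> at all coordinates: the empty logical
    meet.\<close>
  proof (rule tot_pairsI[where S = "{?t}"])
    show "{?t} \<subseteq> tot_sections"
      using t is_dframeD(8)[OF dframes] unfolding tot_sections_def by simp
    fix v assume v: "v \<in> res_prod I (\<lambda>i. neg (\<L> i))" and "\<And>t. t \<in> {?t} \<Longrightarrow> below_section v t"
    then obtain i where "i \<in> I" "v i \<sqsubseteq>\<^bsub>neg (\<L> i)\<^esub> snd (?t i)" unfolding below_section_def by blast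
    then show "v \<in> null_ideal I (\<lambda>i. neg (\<L> i))" using le_bottom_null[OF v] by (simp add: tt_def)
  qed (use t in \<open>auto simp: P.C_ideal_res_prod N.C_ideal_null\<close>)
  then show ?thesis by (simp add: tt_def coprod_pos_def coprod_neg_def P.coprod_top N.coprod_bottom)
qed

lemma ff_tot_pairs: "ff (coprod_pos I \<L>) (coprod_neg I \<L>) \<in> tot_pairs"
proof -
  have "(null_ideal I (\<lambda>i. pos (\<L> i)), res_prod I (\<lambda>i. neg (\<L> i))) \<in> tot_pairs"
    \<comment> \<open>The empty logical join has no clause at all, so its condition on the second
      component holds for every tuple.\<close>
    by (rule tot_pairsI[where S = "{}"]) (simp_all add: P.C_ideal_null N.C_ideal_res_prod)
  then show ?thesis by (simp add: ff_def coprod_pos_def coprod_neg_def N.coprod_top P.coprod_bottom)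
qed

lemma tot_pairs_up: "info_up_closed (coprod_pos I \<L>) (coprod_neg I \<L>) tot_pairs"
  unfolding info_up_closed_def
proof (intro ballI impI)
  fix \<alpha> \<beta> assume \<alpha>: "\<alpha> \<in> tot_pairs" and \<beta>: "\<beta> \<in> carrier (coprod_pos I \<L>) \<times> carrier (coprod_neg I \<L>)"
    and le: "info_le (coprod_pos I \<L>) (coprod_neg I \<L>) \<alpha> \<beta>"
  obtain U V where UV: "(U, V) \<in> tot_pairs" "\<alpha> = (U, V)" using \<alpha> by (cases \<alpha>) auto
  obtain U' V' where UV': "\<beta> = (U', V')" "C_ideal I (\<lambda>i. pos (\<L> i)) U'" "C_ideal I (\<lambda>i. neg (\<L> i)) V'"
    using \<beta> by auto
  have sub: "U \<subseteq> U'" "V \<subseteq> V'" using le UV(2) UV'(1) by (auto simp: info_le_def)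
  obtain S where "tot_witness S U V" using UV(1) by (rule tot_pairsE)
  then have "tot_witness S U' V'" unfolding tot_witness_def using sub by blast
  then show "\<beta> \<in> tot_pairs" using UV' by (auto simp: tot_pairs_def)
qed

text \<open>The logical join of two normal forms is the union of their sets of clauses.\<close>

lemma tot_pairs_or:
  assumes "(U, V) \<in> tot_pairs" "(U', V') \<in> tot_pairs"
  shows "(U \<squnion>\<^bsub>coprod_pos I \<L>\<^esub> U', V \<inter> V') \<in> tot_pairs"
proof -
  interpret FP: frame "coprod_pos I \<L>" by (rule frame_coprod_pos)
  obtain S where wS: "tot_witness S U V"
    and id: "C_ideal I (\<lambda>i. pos (\<L> i)) U" "C_ideal I (\<lambda>i. neg (\<L> i)) V"
    using assms(1) by (rule tot_pairsE)
  note S = tot_witnessD[OF wS]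
  obtain S' where wS': "tot_witness S' U' V'"
    and id': "C_ideal I (\<lambda>i. pos (\<L> i)) U'" "C_ideal I (\<lambda>i. neg (\<L> i)) V'"
    using assms(2) by (rule tot_pairsE)
  note S' = tot_witnessD[OF wS']
  have sub: "U \<subseteq> U \<squnion>\<^bsub>coprod_pos I \<L>\<^esub> U'" "U' \<subseteq> U \<squnion>\<^bsub>coprod_pos I \<L>\<^esub> U'"
    using FP.join_left[of U U'] FP.join_right[of U U'] id id' by simp_all
  show ?thesis
  proof (rule tot_pairsI[where S = "S \<union> S'"])
    show "C_ideal I (\<lambda>i. pos (\<L> i)) (U \<squnion>\<^bsub>coprod_pos I \<L>\<^esub> U')"
      using FP.join_closed[of U U'] id id' by simp
    show "C_ideal I (\<lambda>i. neg (\<L> i)) (V \<inter> V')" using id(2) id'(2) by (rule N.C_ideal_Int)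
    show "(\<lambda>i\<in>I. fst (t i)) \<in> U \<squnion>\<^bsub>coprod_pos I \<L>\<^esub> U'" if "t \<in> S \<union> S'" for t
      using that S(3) S'(3) sub by blast
    show "v \<in> V \<inter> V'"
      if "v \<in> res_prod I (\<lambda>i. neg (\<L> i))" "\<And>t. t \<in> S \<union> S' \<Longrightarrow> below_section v t" for v
      using that S(4)[of v] S'(4)[of v] by blast
  qed (use S S' in auto)
qed

definition section_and :: "('i \<Rightarrow> 'a \<times> 'b) \<Rightarrow> ('i \<Rightarrow> 'a \<times> 'b) \<Rightarrow> 'i \<Rightarrow> 'a \<times> 'b" where
  "section_and t s = (\<lambda>i. log_and (pos (\<L> i)) (neg (\<L> i)) (t i) (s i))"

lemma section_and:
  assumes t: "t \<in> tot_sections" and s: "s \<in> tot_sections"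
  shows "section_and t s \<in> tot_sections"
    and "(\<lambda>i\<in>I. fst (section_and t s i)) = P.res_meet (\<lambda>i\<in>I. fst (t i)) (\<lambda>i\<in>I. fst (s i))"
proof -
  show eq: "(\<lambda>i\<in>I. fst (section_and t s i)) = P.res_meet (\<lambda>i\<in>I. fst (t i)) (\<lambda>i\<in>I. fst (s i))"
    by (auto simp: section_and_def P.res_meet_def log_and_def fun_eq_iff)
  have "(\<lambda>i\<in>I. fst (section_and t s i)) \<in> res_prod I (\<lambda>i. pos (\<L> i))"
    unfolding eq using t s by (intro P.res_meet_mem) (auto simp: tot_sections_def)
  moreover have "section_and t s i \<in> tot (\<L> i)" if "i \<in> I" for i
    using is_dframeD(12)[OF dframes[OF that]] t s that
    by (simp add: section_and_def log_closed_def tot_sections_def)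
  ultimately show "section_and t s \<in> tot_sections" by (simp add: tot_sections_def)
qed

text \<open>The clauses of a logical meet of normal forms are the meets
  \<open>section_and t s\<close>. On the positive side this is a meet of tuples. On the negative
  side a tuple is only below a binary join at some coordinate, for each pair of clauses, and has to
  be cut up by \<open>C_ideal_split\<close>.\<close>

lemma tot_pairs_and:
  assumes "(U, V) \<in> tot_pairs" "(U', V') \<in> tot_pairs"
  shows "(U \<inter> U', V \<squnion>\<^bsub>coprod_neg I \<L>\<^esub> V') \<in> tot_pairs"
proof -
  interpret FN: frame "coprod_neg I \<L>" by (rule frame_coprod_neg)
  obtain S where wS: "tot_witness S U V"
    and id: "C_ideal I (\<lambda>i. pos (\<L> i)) U" "C_ideal I (\<lambda>i. neg (\<L> i)) V"
    using assms(1) by (rule tot_pairsE)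
  note S = tot_witnessD[OF wS]
  obtain S' where wS': "tot_witness S' U' V'"
    and id': "C_ideal I (\<lambda>i. pos (\<L> i)) U'" "C_ideal I (\<lambda>i. neg (\<L> i)) V'"
    using assms(2) by (rule tot_pairsE)
  note S' = tot_witnessD[OF wS']
  let ?W = "V \<squnion>\<^bsub>coprod_neg I \<L>\<^esub> V'"
  have W: "C_ideal I (\<lambda>i. neg (\<L> i)) ?W" using FN.join_closed[of V V'] id id' by simp
  have sub: "V \<subseteq> ?W" "V' \<subseteq> ?W"
    using FN.join_left[of V V'] FN.join_right[of V V'] id id' by simp_all
  have sec: "t \<in> tot_sections" "s \<in> tot_sections" if "(t, s) \<in> S \<times> S'" for t s
    using that S(2) S'(2) by auto
  show ?thesis
  proof (rule tot_pairsI[where S = "(\<lambda>(t, s). section_and t s) ` (S \<times> S')"])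
    show "C_ideal I (\<lambda>i. pos (\<L> i)) (U \<inter> U')" using id(1) id'(1) by (rule P.C_ideal_Int)
    show "C_ideal I (\<lambda>i. neg (\<L> i)) ?W" by (rule W)
    show "finite ((\<lambda>(t, s). section_and t s) ` (S \<times> S'))" using S(1) S'(1) by simp
    show "(\<lambda>(t, s). section_and t s) ` (S \<times> S') \<subseteq> tot_sections"
      using section_and(1) sec by auto
    fix r assume "r \<in> (\<lambda>(t, s). section_and t s) ` (S \<times> S')"
    then obtain t s where ts: "t \<in> S" "s \<in> S'" "r = section_and t s" by auto
    show "(\<lambda>i\<in>I. fst (r i)) \<in> U \<inter> U'"
      unfolding ts(3) section_and(2)[OF subsetD[OF S(2) ts(1)] subsetD[OF S'(2) ts(2)]]
      by (rule P.C_ideal_res_meet[OF id(1) id'(1) S(3)[OF ts(1)] S'(3)[OF ts(2)]])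
  next
    fix v assume v: "v \<in> res_prod I (\<lambda>i. neg (\<L> i))"
      and below: "\<And>r. r \<in> (\<lambda>(t, s). section_and t s) ` (S \<times> S') \<Longrightarrow> below_section v r"
    show "v \<in> ?W"
    proof (rule N.C_ideal_split[OF W _ v, where Q = "S \<times> S'" and x = "\<lambda>q j. snd (fst q j)"
          and y = "\<lambda>q j. snd (snd q j)"])
      show "finite (S \<times> S')" using S(1) S'(1) by simp
      fix q assume q: "q \<in> S \<times> S'"
      obtain t s where ts: "q = (t, s)" by (cases q)
      show "snd (fst q j) \<in> carrier (neg (\<L> j)) \<and> snd (snd q j) \<in> carrier (neg (\<L> j))" if "j \<in> I" for j
        using sec[of t s] q ts that tot_carrier[OF that, of "fst (t j)" "snd (t j)"]
          tot_carrier[OF that, of "fst (s j)" "snd (s j)"] by (simp add: tot_sections_def)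
      have "below_section v (section_and t s)" using below[of "section_and t s"] q ts by blast
      then show "\<exists>j\<in>I. v j \<sqsubseteq>\<^bsub>neg (\<L> j)\<^esub> snd (fst q j) \<squnion>\<^bsub>neg (\<L> j)\<^esub> snd (snd q j)"
        using ts by (simp add: below_section_def section_and_def log_and_def)
    next
      fix w assume w: "w \<in> res_prod I (\<lambda>i. neg (\<L> i))"
        and alt: "\<And>q. q \<in> S \<times> S' \<Longrightarrow> (\<exists>j\<in>I. w j \<sqsubseteq>\<^bsub>neg (\<L> j)\<^esub> snd (fst q j)) \<or>
          (\<exists>j\<in>I. w j \<sqsubseteq>\<^bsub>neg (\<L> j)\<^esub> snd (snd q j))"
      have "below_section w t \<or> below_section w s" if "t \<in> S" "s \<in> S'" for t s
        using alt[of "(t, s)"] that by (simp add: below_section_def)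
      \<comment> \<open>If the piece \<open>w\<close> fails for one \<open>t\<close>, the
        alternatives for the pairs with that \<open>t\<close> make it lie below every
        \<open>s\<close>. So it satisfies one of the two original normal forms as a whole.\<close>
      then have "(\<forall>t\<in>S. below_section w t) \<or> (\<forall>s\<in>S'. below_section w s)" by blast
      then have "w \<in> V \<or> w \<in> V'" using S(4)[OF w] S'(4)[OF w] by blast
      then show "w \<in> ?W" using sub by blast
    qed
  qed
qed

lemma tot_pairs_log: "log_closed (coprod_pos I \<L>) (coprod_neg I \<L>) tot_pairs"
  unfolding log_closed_def
proof (intro ballI)
  fix \<alpha> \<beta> assume ab: "\<alpha> \<in> tot_pairs" "\<beta> \<in> tot_pairs"
  obtain U V U' V' where eq: "\<alpha> = (U, V)" "\<beta> = (U', V')" by (cases \<alpha>, cases \<beta>) auto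
  have id: "C_ideal I (\<lambda>i. pos (\<L> i)) U" "C_ideal I (\<lambda>i. pos (\<L> i)) U'"
    "C_ideal I (\<lambda>i. neg (\<L> i)) V" "C_ideal I (\<lambda>i. neg (\<L> i)) V'"
    using ab eq by (auto simp: tot_pairs_def)
  show "log_and (coprod_pos I \<L>) (coprod_neg I \<L>) \<alpha> \<beta> \<in> tot_pairs \<and>
    log_or (coprod_pos I \<L>) (coprod_neg I \<L>) \<alpha> \<beta> \<in> tot_pairs"
    using ab tot_pairs_and[of U V U' V'] tot_pairs_or[of U V U' V']
      P.coprod_meet[OF id(1,2)] N.coprod_meet[OF id(3,4)]
    unfolding eq by (simp add: log_and_def log_or_def flip: coprod_pos_def coprod_neg_def)
qed

lemma tot_pairs_carrier: "tot_pairs \<subseteq> carrier (coprod_pos I \<L>) \<times> carrier (coprod_neg I \<L>)"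
  by (auto simp: tot_pairs_def)

section \<open>\<open>Con_star\<close> and \<open>Tot_star\<close> as least closed sets\<close>

lemma Tot_star_least:
  assumes "X \<subseteq> carrier (coprod_pos I \<L>) \<times> carrier (coprod_neg I \<L>)" "tot1 I \<L> \<subseteq> X"
    and "tt (coprod_pos I \<L>) (coprod_neg I \<L>) \<in> X" "ff (coprod_pos I \<L>) (coprod_neg I \<L>) \<in> X"
    and "info_up_closed (coprod_pos I \<L>) (coprod_neg I \<L>) X"
    and "log_closed (coprod_pos I \<L>) (coprod_neg I \<L>) X"
  shows "Tot_star I \<L> \<subseteq> X"
  unfolding Tot_star_def by (rule Inter_lower) (use assms in blast)

lemma Con_star_least:
  assumes "X \<subseteq> carrier (coprod_pos I \<L>) \<times> carrier (coprod_neg I \<L>)" "con1 I \<L> \<subseteq> X"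
    and "tt (coprod_pos I \<L>) (coprod_neg I \<L>) \<in> X" "ff (coprod_pos I \<L>) (coprod_neg I \<L>) \<in> X"
    and "info_down_closed (coprod_pos I \<L>) (coprod_neg I \<L>) X"
    and "log_closed (coprod_pos I \<L>) (coprod_neg I \<L>) X"
    and "directed_join_closed (coprod_pos I \<L>) (coprod_neg I \<L>) X"
  shows "Con_star I \<L> \<subseteq> X"
  unfolding Con_star_def by (rule Inter_lower) (use assms in blast)

lemma Con_star_con_pairs: "Con_star I \<L> \<subseteq> con_pairs"
  using con_pairs_carrier con1_subset tt_con_pairs ff_con_pairs con_pairs_down con_pairs_log
    con_pairs_directed by (rule Con_star_least)

lemma Tot_star_tot_pairs: "Tot_star I \<L> \<subseteq> tot_pairs"
  using tot_pairs_carrier tot1_subset tt_tot_pairs ff_tot_pairs tot_pairs_up tot_pairs_log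
  by (rule Tot_star_least)

text \<open>Every condition on \<open>X\<close> says that some elements belong to it, possibly under
  the premise that others do; such conditions pass to intersections.\<close>

lemma Con_star_closed:
  shows "con1 I \<L> \<subseteq> Con_star I \<L>"
    and "tt (coprod_pos I \<L>) (coprod_neg I \<L>) \<in> Con_star I \<L>"
    and "ff (coprod_pos I \<L>) (coprod_neg I \<L>) \<in> Con_star I \<L>"
    and "info_down_closed (coprod_pos I \<L>) (coprod_neg I \<L>) (Con_star I \<L>)"
    and "log_closed (coprod_pos I \<L>) (coprod_neg I \<L>) (Con_star I \<L>)"
    and "directed_join_closed (coprod_pos I \<L>) (coprod_neg I \<L>) (Con_star I \<L>)"
proof -
  let ?P = "coprod_pos I \<L>" and ?N = "coprod_neg I \<L>"
  define \<X> where "\<X> = {X. X \<subseteq> carrier ?P \<times> carrier ?N \<and> con1 I \<L> \<subseteq> X \<and> tt ?P ?N \<in> X \<and>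
    ff ?P ?N \<in> X \<and> info_down_closed ?P ?N X \<and> log_closed ?P ?N X \<and> directed_join_closed ?P ?N X}"
  have eq: "Con_star I \<L> = \<Inter>\<X>" by (simp add: Con_star_def \<X>_def)
  have X: "con1 I \<L> \<subseteq> X \<and> tt ?P ?N \<in> X \<and> ff ?P ?N \<in> X \<and> info_down_closed ?P ?N X \<and>
    log_closed ?P ?N X \<and> directed_join_closed ?P ?N X" if "X \<in> \<X>" for X
    using that by (simp add: \<X>_def)
  show "con1 I \<L> \<subseteq> Con_star I \<L>" "tt ?P ?N \<in> Con_star I \<L>" "ff ?P ?N \<in> Con_star I \<L>"
    unfolding eq using X by blast+
  show "info_down_closed ?P ?N (Con_star I \<L>)"
    unfolding info_down_closed_def eq
  proof (intro ballI impI InterI)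
    fix \<alpha> \<beta> X assume "\<beta> \<in> \<Inter>\<X>" "\<alpha> \<in> carrier ?P \<times> carrier ?N" "info_le ?P ?N \<alpha> \<beta>" "X \<in> \<X>"
    then show "\<alpha> \<in> X" using X[of X] unfolding info_down_closed_def by blast
  qed
  show "log_closed ?P ?N (Con_star I \<L>)"
    unfolding log_closed_def eq
  proof (intro ballI conjI InterI)
    fix \<alpha> \<beta> X assume "\<alpha> \<in> \<Inter>\<X>" "\<beta> \<in> \<Inter>\<X>" "X \<in> \<X>"
    then show "log_and ?P ?N \<alpha> \<beta> \<in> X" "log_or ?P ?N \<alpha> \<beta> \<in> X"
      using X[of X] unfolding log_closed_def by blast+
  qed
  show "directed_join_closed ?P ?N (Con_star I \<L>)"
    unfolding directed_join_closed_def eq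
  proof (intro allI impI InterI)
    fix D X assume "D \<subseteq> \<Inter>\<X>" "info_directed ?P ?N D" "X \<in> \<X>"
    then show "(\<Squnion>\<^bsub>?P\<^esub> (fst ` D), \<Squnion>\<^bsub>?N\<^esub> (snd ` D)) \<in> X"
      using X[of X] Inter_lower[of X \<X>] unfolding directed_join_closed_def by (meson order_trans)
  qed
qed

lemma Tot_star_closed:
  shows "tot1 I \<L> \<subseteq> Tot_star I \<L>"
    and "tt (coprod_pos I \<L>) (coprod_neg I \<L>) \<in> Tot_star I \<L>"
    and "ff (coprod_pos I \<L>) (coprod_neg I \<L>) \<in> Tot_star I \<L>"
    and "info_up_closed (coprod_pos I \<L>) (coprod_neg I \<L>) (Tot_star I \<L>)"
    and "log_closed (coprod_pos I \<L>) (coprod_neg I \<L>) (Tot_star I \<L>)"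
proof -
  let ?P = "coprod_pos I \<L>" and ?N = "coprod_neg I \<L>"
  define \<X> where "\<X> = {X. X \<subseteq> carrier ?P \<times> carrier ?N \<and> tot1 I \<L> \<subseteq> X \<and> tt ?P ?N \<in> X \<and>
    ff ?P ?N \<in> X \<and> info_up_closed ?P ?N X \<and> log_closed ?P ?N X}"
  have eq: "Tot_star I \<L> = \<Inter>\<X>" by (simp add: Tot_star_def \<X>_def)
  have X: "tot1 I \<L> \<subseteq> X \<and> tt ?P ?N \<in> X \<and> ff ?P ?N \<in> X \<and> info_up_closed ?P ?N X \<and>
    log_closed ?P ?N X" if "X \<in> \<X>" for X
    using that by (simp add: \<X>_def)
  show "tot1 I \<L> \<subseteq> Tot_star I \<L>" "tt ?P ?N \<in> Tot_star I \<L>" "ff ?P ?N \<in> Tot_star I \<L>"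
    unfolding eq using X by blast+
  show "info_up_closed ?P ?N (Tot_star I \<L>)"
    unfolding info_up_closed_def eq
  proof (intro ballI impI InterI)
    fix \<alpha> \<beta> X assume "\<alpha> \<in> \<Inter>\<X>" "\<beta> \<in> carrier ?P \<times> carrier ?N" "info_le ?P ?N \<alpha> \<beta>" "X \<in> \<X>"
    then show "\<beta> \<in> X" using X[of X] unfolding info_up_closed_def by blast
  qed
  show "log_closed ?P ?N (Tot_star I \<L>)"
    unfolding log_closed_def eq
  proof (intro ballI conjI InterI)
    fix \<alpha> \<beta> X assume "\<alpha> \<in> \<Inter>\<X>" "\<beta> \<in> \<Inter>\<X>" "X \<in> \<X>"
    then show "log_and ?P ?N \<alpha> \<beta> \<in> X" "log_or ?P ?N \<alpha> \<beta> \<in> X"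
      using X[of X] unfolding log_closed_def by blast+
  qed
qed

lemma con_tot_fst:
  assumes "(U, V) \<in> Con_star I \<L>" "(U, V') \<in> Tot_star I \<L>"
  shows "V \<subseteq> V'"
  using con_pairs_tot_pairs[of U V U V'] assms Con_star_con_pairs Tot_star_tot_pairs by blast

end

section \<open>Exchange of the two frames and the d-frame axioms for the coproduct\<close>

lemma coprod_dual:
  "coprod_pos I (\<lambda>i. dframe_dual (\<L> i)) = coprod_neg I \<L>"
  "coprod_neg I (\<lambda>i. dframe_dual (\<L> i)) = coprod_pos I \<L>"
  "con1 I (\<lambda>i. dframe_dual (\<L> i)) = (con1 I \<L>)\<inverse>"
  "tot1 I (\<lambda>i. dframe_dual (\<L> i)) = (tot1 I \<L>)\<inverse>"
proof -
  have "inj_pos I (\<lambda>i. dframe_dual (\<L> i)) = inj_neg I \<L>"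
    "inj_neg I (\<lambda>i. dframe_dual (\<L> i)) = inj_pos I \<L>"
    by (simp_all add: inj_pos_def inj_neg_def fun_eq_iff)
  then show "con1 I (\<lambda>i. dframe_dual (\<L> i)) = (con1 I \<L>)\<inverse>"
    "tot1 I (\<lambda>i. dframe_dual (\<L> i)) = (tot1 I \<L>)\<inverse>"
    unfolding con1_def tot1_def by auto
qed (simp_all add: coprod_pos_def coprod_neg_def)

context dframe_family
begin

text \<open>The converse of the closure for the dual family satisfies all conditions of the closure
  for the original one, so leastness of \<open>Con_star\<close> gives the inclusion. Membership is
  thereby transported to the dual family, as (con-tot) for equal second components requires.\<close>

lemma Con_star_dual: "(Con_star I \<L>)\<inverse> \<subseteq> Con_star I (\<lambda>i. dframe_dual (\<L> i))"
proof -
  interpret D: dframe_family I "\<lambda>i. dframe_dual (\<L> i)" by (rule dual_family)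
  let ?X = "(Con_star I (\<lambda>i. dframe_dual (\<L> i)))\<inverse>"
  note c = D.Con_star_closed[unfolded coprod_dual]
  have "Con_star I \<L> \<subseteq> ?X"
  proof (rule Con_star_least)
    \<comment> \<open>The bound \<open>con_pairs\<close> of the dual family keeps the closure inside
      the carrier.\<close>
    show "?X \<subseteq> carrier (coprod_pos I \<L>) \<times> carrier (coprod_neg I \<L>)"
      using D.Con_star_con_pairs D.con_pairs_carrier unfolding coprod_dual by blast
    show "con1 I \<L> \<subseteq> ?X" using c(1) by (simp add: converse_subset_swap)
    show "tt (coprod_pos I \<L>) (coprod_neg I \<L>) \<in> ?X" using c(3) by (simp add: tt_def ff_def)
    show "ff (coprod_pos I \<L>) (coprod_neg I \<L>) \<in> ?X" using c(2) by (simp add: tt_def ff_def)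
    show "info_down_closed (coprod_pos I \<L>) (coprod_neg I \<L>) ?X"
      using c(4) by (rule info_down_closed_converse)
    show "log_closed (coprod_pos I \<L>) (coprod_neg I \<L>) ?X" using c(5) by (rule log_closed_converse)
    show "directed_join_closed (coprod_pos I \<L>) (coprod_neg I \<L>) ?X"
      using c(6) by (rule directed_join_closed_converse)
  qed
  then show ?thesis by (simp add: converse_subset_swap)
qed

lemma Tot_star_dual: "(Tot_star I \<L>)\<inverse> \<subseteq> Tot_star I (\<lambda>i. dframe_dual (\<L> i))"
proof -
  interpret D: dframe_family I "\<lambda>i. dframe_dual (\<L> i)" by (rule dual_family)
  let ?X = "(Tot_star I (\<lambda>i. dframe_dual (\<L> i)))\<inverse>"
  note c = D.Tot_star_closed[unfolded coprod_dual]
  have "Tot_star I \<L> \<subseteq> ?X"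
  proof (rule Tot_star_least)
    show "?X \<subseteq> carrier (coprod_pos I \<L>) \<times> carrier (coprod_neg I \<L>)"
      using D.Tot_star_tot_pairs D.tot_pairs_carrier unfolding coprod_dual by blast
    show "tot1 I \<L> \<subseteq> ?X" using c(1) by (simp add: converse_subset_swap)
    show "tt (coprod_pos I \<L>) (coprod_neg I \<L>) \<in> ?X" using c(3) by (simp add: tt_def ff_def)
    show "ff (coprod_pos I \<L>) (coprod_neg I \<L>) \<in> ?X" using c(2) by (simp add: tt_def ff_def)
    show "info_up_closed (coprod_pos I \<L>) (coprod_neg I \<L>) ?X"
      using c(4) by (rule info_up_closed_converse)
    show "log_closed (coprod_pos I \<L>) (coprod_neg I \<L>) ?X" using c(5) by (rule log_closed_converse)
  qed
  then show ?thesis by (simp add: converse_subset_swap)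
qed

lemma con_tot_snd:
  assumes "(U, V) \<in> Con_star I \<L>" "(U', V) \<in> Tot_star I \<L>"
  shows "U \<subseteq> U'"
proof -
  interpret D: dframe_family I "\<lambda>i. dframe_dual (\<L> i)" by (rule dual_family)
  show ?thesis using D.con_tot_fst[of V U U'] Con_star_dual Tot_star_dual assms by blast
qed

lemma is_dframe_coprod: "is_dframe (dframe_coprod I \<L>)"
proof -
  have "info_le (coprod_pos I \<L>) (coprod_neg I \<L>) \<alpha> \<beta>"
    if "\<alpha> \<in> Con_star I \<L>" "\<beta> \<in> Tot_star I \<L>" "fst \<alpha> = fst \<beta> \<or> snd \<alpha> = snd \<beta>" for \<alpha> \<beta>
    using that con_tot_fst[of "fst \<alpha>" "snd \<alpha>" "snd \<beta>"] con_tot_snd[of "fst \<alpha>" "snd \<alpha>" "fst \<beta>"]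
    by (cases \<alpha>; cases \<beta>) (auto simp: info_le_def)
  moreover have "Con_star I \<L> \<subseteq> carrier (coprod_pos I \<L>) \<times> carrier (coprod_neg I \<L>)"
    using Con_star_con_pairs con_pairs_carrier by (rule order_trans)
  moreover have "Tot_star I \<L> \<subseteq> carrier (coprod_pos I \<L>) \<times> carrier (coprod_neg I \<L>)"
    using Tot_star_tot_pairs tot_pairs_carrier by (rule order_trans)
  ultimately show ?thesis
    unfolding is_dframe_def dframe_coprod_def dframe.simps
    using frame_coprod_pos frame_coprod_neg Con_star_closed(2-) Tot_star_closed(2-) by blast
qed

lemma dframe_inj_hom:
  assumes j: "j \<in> I"
  shows "dframe_inj I \<L> j \<in> dframe_hom (\<L> j) (dframe_coprod I \<L>)"
proof -
  have "(inj_pos I \<L> j a, inj_neg I \<L> j b) \<in> Con_star I \<L>" if "(a, b) \<in> con (\<L> j)" for a b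
    using Con_star_closed(1) that j by (auto simp: con1_def)
  moreover have "(inj_pos I \<L> j a, inj_neg I \<L> j b) \<in> Tot_star I \<L>" if "(a, b) \<in> tot (\<L> j)" for a b
    using Tot_star_closed(1) that j by (auto simp: tot1_def)
  ultimately show ?thesis
    using P.coprod_inj_hom[OF j] N.coprod_inj_hom[OF j]
    by (simp add: dframe_hom_def dframe_inj_def dframe_coprod_def coprod_pos_def coprod_neg_def
        inj_pos_eq inj_neg_eq)
qed

end

section \<open>Preimages under pairs of frame homomorphisms, and the universal property\<close>

lemma hom_vimage_down_closed:
  assumes "frame P" "frame P'" "frame N" "frame N'"
    and g: "g \<in> frame_hom P P'" and k: "k \<in> frame_hom N N'" and X: "info_down_closed P' N' X"
  shows "info_down_closed P N {\<alpha> \<in> carrier P \<times> carrier N. (g (fst \<alpha>), k (snd \<alpha>)) \<in> X}"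
  unfolding info_down_closed_def
proof (intro ballI impI)
  fix \<alpha> \<beta>
  assume \<beta>: "\<beta> \<in> {\<alpha> \<in> carrier P \<times> carrier N. (g (fst \<alpha>), k (snd \<alpha>)) \<in> X}"
    and \<alpha>: "\<alpha> \<in> carrier P \<times> carrier N" and le: "info_le P N \<alpha> \<beta>"
  have "info_le P' N' (g (fst \<alpha>), k (snd \<alpha>)) (g (fst \<beta>), k (snd \<beta>))"
    using frame_hom_mono[OF assms(1,2) g, of "fst \<alpha>" "fst \<beta>"]
      frame_hom_mono[OF assms(3,4) k, of "snd \<alpha>" "snd \<beta>"] \<alpha> \<beta> le by (auto simp: info_le_def)
  moreover have "(g (fst \<alpha>), k (snd \<alpha>)) \<in> carrier P' \<times> carrier N'"
    using frame_homD(2)[OF g] frame_homD(2)[OF k] \<alpha> by auto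
  ultimately show "\<alpha> \<in> {\<alpha> \<in> carrier P \<times> carrier N. (g (fst \<alpha>), k (snd \<alpha>)) \<in> X}"
    using X \<alpha> \<beta> unfolding info_down_closed_def by blast
qed

lemma hom_vimage_up_closed:
  assumes "frame P" "frame P'" "frame N" "frame N'"
    and g: "g \<in> frame_hom P P'" and k: "k \<in> frame_hom N N'" and X: "info_up_closed P' N' X"
  shows "info_up_closed P N {\<alpha> \<in> carrier P \<times> carrier N. (g (fst \<alpha>), k (snd \<alpha>)) \<in> X}"
  unfolding info_up_closed_def
proof (intro ballI impI)
  fix \<alpha> \<beta>
  assume \<alpha>: "\<alpha> \<in> {\<alpha> \<in> carrier P \<times> carrier N. (g (fst \<alpha>), k (snd \<alpha>)) \<in> X}"
    and \<beta>: "\<beta> \<in> carrier P \<times> carrier N" and le: "info_le P N \<alpha> \<beta>"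
  have "info_le P' N' (g (fst \<alpha>), k (snd \<alpha>)) (g (fst \<beta>), k (snd \<beta>))"
    using frame_hom_mono[OF assms(1,2) g, of "fst \<alpha>" "fst \<beta>"]
      frame_hom_mono[OF assms(3,4) k, of "snd \<alpha>" "snd \<beta>"] \<alpha> \<beta> le by (auto simp: info_le_def)
  moreover have "(g (fst \<beta>), k (snd \<beta>)) \<in> carrier P' \<times> carrier N'"
    using frame_homD(2)[OF g] frame_homD(2)[OF k] \<beta> by auto
  ultimately show "\<beta> \<in> {\<alpha> \<in> carrier P \<times> carrier N. (g (fst \<alpha>), k (snd \<alpha>)) \<in> X}"
    using X \<alpha> \<beta> unfolding info_up_closed_def by blast
qed

lemma hom_vimage_log_closed:
  assumes "frame P" "frame N"
    and g: "g \<in> frame_hom P P'" and k: "k \<in> frame_hom N N'" and X: "log_closed P' N' X"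
  shows "log_closed P N {\<alpha> \<in> carrier P \<times> carrier N. (g (fst \<alpha>), k (snd \<alpha>)) \<in> X}" (is "log_closed P N ?Y")
  unfolding log_closed_def
proof (intro ballI)
  interpret P: frame P by fact
  interpret N: frame N by fact
  fix \<alpha> \<beta> assume ab: "\<alpha> \<in> ?Y" "\<beta> \<in> ?Y"
  then have c: "fst \<alpha> \<in> carrier P" "snd \<alpha> \<in> carrier N" "fst \<beta> \<in> carrier P" "snd \<beta> \<in> carrier N"
    by auto
  have "log_and P' N' (g (fst \<alpha>), k (snd \<alpha>)) (g (fst \<beta>), k (snd \<beta>)) \<in> X"
    "log_or P' N' (g (fst \<alpha>), k (snd \<alpha>)) (g (fst \<beta>), k (snd \<beta>)) \<in> X"
    using X ab unfolding log_closed_def by blast+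
  then show "log_and P N \<alpha> \<beta> \<in> ?Y \<and> log_or P N \<alpha> \<beta> \<in> ?Y"
    using c frame_homD(4)[OF g] frame_homD(4)[OF k] frame_hom_join[OF g] frame_hom_join[OF k]
    by (simp add: log_and_def log_or_def)
qed

lemma hom_vimage_directed_join_closed:
  assumes "frame P" "frame P'" "frame N" "frame N'"
    and g: "g \<in> frame_hom P P'" and k: "k \<in> frame_hom N N'" and X: "directed_join_closed P' N' X"
  shows "directed_join_closed P N {\<alpha> \<in> carrier P \<times> carrier N. (g (fst \<alpha>), k (snd \<alpha>)) \<in> X}"
    (is "directed_join_closed P N ?Y")
  unfolding directed_join_closed_def
proof (intro allI impI)
  interpret P: frame P by fact
  interpret N: frame N by fact
  fix D assume D: "D \<subseteq> ?Y" and dir: "info_directed P N D"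
  let ?h = "\<lambda>\<alpha>. (g (fst \<alpha>), k (snd \<alpha>))"
  have fD: "fst ` D \<subseteq> carrier P" and sD: "snd ` D \<subseteq> carrier N" using D by auto
  have "info_directed P' N' (?h ` D)"
    unfolding info_directed_def
  proof (intro conjI ballI)
    show "?h ` D \<noteq> {}" using dir by (simp add: info_directed_def)
    fix \<alpha>' \<beta>' assume "\<alpha>' \<in> ?h ` D" "\<beta>' \<in> ?h ` D"
    then obtain \<alpha> \<beta> where ab: "\<alpha> \<in> D" "\<beta> \<in> D" and eq: "\<alpha>' = ?h \<alpha>" "\<beta>' = ?h \<beta>" by blast
    obtain \<gamma> where \<gamma>: "\<gamma> \<in> D" "info_le P N \<alpha> \<gamma>" "info_le P N \<beta> \<gamma>"
      using dir ab unfolding info_directed_def by blast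
    have mono: "info_le P' N' (?h \<delta>) (?h \<gamma>)" if "\<delta> \<in> D" "info_le P N \<delta> \<gamma>" for \<delta>
      using frame_hom_mono[OF assms(1,2) g, of "fst \<delta>" "fst \<gamma>"]
        frame_hom_mono[OF assms(3,4) k, of "snd \<delta>" "snd \<gamma>"] that \<gamma>(1) fD sD
      by (simp add: info_le_def image_subset_iff)
    show "\<exists>\<gamma>\<in>?h ` D. info_le P' N' \<alpha>' \<gamma> \<and> info_le P' N' \<beta>' \<gamma>"
      unfolding eq using mono[OF ab(1) \<gamma>(2)] mono[OF ab(2) \<gamma>(3)] \<gamma>(1) by blast
  qed
  moreover have "?h ` D \<subseteq> X" using D by blast
  ultimately have "(\<Squnion>\<^bsub>P'\<^esub> (fst ` ?h ` D), \<Squnion>\<^bsub>N'\<^esub> (snd ` ?h ` D)) \<in> X"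
    using X unfolding directed_join_closed_def by blast
  then have "(g (\<Squnion>\<^bsub>P\<^esub> (fst ` D)), k (\<Squnion>\<^bsub>N\<^esub> (snd ` D))) \<in> X"
    using frame_homD(5)[OF g fD] frame_homD(5)[OF k sD] by (simp add: image_image)
  then show "(\<Squnion>\<^bsub>P\<^esub> (fst ` D), \<Squnion>\<^bsub>N\<^esub> (snd ` D)) \<in> ?Y" using fD sD by simp
qed

lemma dframe_homD:
  assumes "h \<in> dframe_hom \<L> \<M>"
  shows "fst h \<in> frame_hom (pos \<L>) (pos \<M>)" "snd h \<in> frame_hom (neg \<L>) (neg \<M>)"
    and "\<alpha> \<in> con \<L> \<Longrightarrow> (fst h (fst \<alpha>), snd h (snd \<alpha>)) \<in> con \<M>"
    and "\<alpha> \<in> tot \<L> \<Longrightarrow> (fst h (fst \<alpha>), snd h (snd \<alpha>)) \<in> tot \<M>"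
  using assms by (auto simp: dframe_hom_def)

text \<open>Both components of the mediating morphism are the copairings of the underlying frame
  cocones, which also settles uniqueness. It remains to see that they respect con and tot.\<close>

lemma (in dframe_family) copair_ex1:
  fixes \<M> :: "('c, 'd) dframe"
  assumes M: "is_dframe \<M>" and f: "\<And>j. j \<in> I \<Longrightarrow> f j \<in> dframe_hom (\<L> j) \<M>"
  shows "\<exists>!h. h \<in> dframe_hom (dframe_coprod I \<L>) \<M> \<and>
             (\<forall>j\<in>I. dframe_comp (\<L> j) h (dframe_inj I \<L> j) = f j)"
proof -
  note d = is_dframeD[OF M]
  interpret CP: frame_cocone I "\<lambda>i. pos (\<L> i)" "pos \<M>" "\<lambda>j. fst (f j)"
    using d(1) dframe_homD(1)[OF f]
    by (intro frame_cocone.intro P.frame_family_axioms frame_cocone_axioms.intro)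
  interpret CN: frame_cocone I "\<lambda>i. neg (\<L> i)" "neg \<M>" "\<lambda>j. snd (f j)"
    using d(2) dframe_homD(2)[OF f]
    by (intro frame_cocone.intro N.frame_family_axioms frame_cocone_axioms.intro)
  let ?P = "coprod_pos I \<L>" and ?N = "coprod_neg I \<L>"
  have g: "CP.copair \<in> frame_hom ?P (pos \<M>)" and k: "CN.copair \<in> frame_hom ?N (neg \<M>)"
    using CP.copair_hom CN.copair_hom by (simp_all add: coprod_pos_def coprod_neg_def)
  interpret FP: frame ?P by (rule frame_coprod_pos)
  interpret FN: frame ?N by (rule frame_coprod_neg)
  note fr = frame_coprod_pos d(1) frame_coprod_neg d(2)
  \<comment> \<open>The preimage of con (or tot) of \<open>\<M>\<close> under the pair of copairings
    is closed under the operations that define \<open>Con_star\<close> (or \<open>Tot_star\<close>).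
    By leastness only the generators have to be checked, and there the copairings return the given
    morphisms.\<close>
  let ?Y = "\<lambda>X. {\<alpha> \<in> carrier ?P \<times> carrier ?N. (CP.copair (fst \<alpha>), CN.copair (snd \<alpha>)) \<in> X}"
  have tt: "tt ?P ?N \<in> ?Y X" if "tt (pos \<M>) (neg \<M>) \<in> X" for X
    using that frame_homD(3)[OF g] frame_hom_bottom[OF fr(3,4) k] FP.top_closed FN.bottom_closed
    by (simp add: tt_def)
  have ff: "ff ?P ?N \<in> ?Y X" if "ff (pos \<M>) (neg \<M>) \<in> X" for X
    using that frame_homD(3)[OF k] frame_hom_bottom[OF fr(1,2) g] FN.top_closed FP.bottom_closed
    by (simp add: ff_def)
  have con: "Con_star I \<L> \<subseteq> ?Y (con \<M>)"
  proof (rule Con_star_least)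
    show "con1 I \<L> \<subseteq> ?Y (con \<M>)"
    proof
      fix \<alpha> assume \<alpha>: "\<alpha> \<in> con1 I \<L>"
      then obtain j a b where j: "j \<in> I" and ab: "(a, b) \<in> con (\<L> j)"
        and eq: "\<alpha> = (P.coprod_inj j a, N.coprod_inj j b)"
        by (auto simp: con1_def inj_pos_eq inj_neg_eq)
      have "(fst (f j) a, snd (f j) b) \<in> con \<M>" using dframe_homD(3)[OF f[OF j] ab] by simp
      then show "\<alpha> \<in> ?Y (con \<M>)"
        using con_carrier[OF j ab] eq j CP.copair_inj[OF j, of a] CN.copair_inj[OF j, of b]
          P.C_ideal_coprod_inj[OF j, of a] N.C_ideal_coprod_inj[OF j, of b] by simp
    qed
    show "tt ?P ?N \<in> ?Y (con \<M>)" using d(7) by (rule tt)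
    show "ff ?P ?N \<in> ?Y (con \<M>)" using d(9) by (rule ff)
    show "info_down_closed ?P ?N (?Y (con \<M>))" by (rule hom_vimage_down_closed[OF fr g k d(5)])
    show "log_closed ?P ?N (?Y (con \<M>))" by (rule hom_vimage_log_closed[OF fr(1,3) g k d(11)])
    show "directed_join_closed ?P ?N (?Y (con \<M>))"
      by (rule hom_vimage_directed_join_closed[OF fr g k d(13)])
  qed blast
  have tot: "Tot_star I \<L> \<subseteq> ?Y (tot \<M>)"
  proof (rule Tot_star_least)
    show "tot1 I \<L> \<subseteq> ?Y (tot \<M>)"
    proof
      fix \<alpha> assume \<alpha>: "\<alpha> \<in> tot1 I \<L>"
      then obtain j a b where j: "j \<in> I" and ab: "(a, b) \<in> tot (\<L> j)"
        and eq: "\<alpha> = (P.coprod_inj j a, N.coprod_inj j b)"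
        by (auto simp: tot1_def inj_pos_eq inj_neg_eq)
      have "(fst (f j) a, snd (f j) b) \<in> tot \<M>" using dframe_homD(4)[OF f[OF j] ab] by simp
      then show "\<alpha> \<in> ?Y (tot \<M>)"
        using tot_carrier[OF j ab] eq j CP.copair_inj[OF j, of a] CN.copair_inj[OF j, of b]
          P.C_ideal_coprod_inj[OF j, of a] N.C_ideal_coprod_inj[OF j, of b] by simp
    qed
    show "tt ?P ?N \<in> ?Y (tot \<M>)" using d(8) by (rule tt)
    show "ff ?P ?N \<in> ?Y (tot \<M>)" using d(10) by (rule ff)
    show "info_up_closed ?P ?N (?Y (tot \<M>))" by (rule hom_vimage_up_closed[OF fr g k d(6)])
    show "log_closed ?P ?N (?Y (tot \<M>))" by (rule hom_vimage_log_closed[OF fr(1,3) g k d(12)])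
  qed blast
  show ?thesis
  proof (rule ex1I[where a = "(CP.copair, CN.copair)"], intro conjI ballI)
    show "(CP.copair, CN.copair) \<in> dframe_hom (dframe_coprod I \<L>) \<M>"
      using g k con tot unfolding dframe_hom_def dframe_coprod_def dframe.simps by auto
    fix j assume j: "j \<in> I"
    \<comment> \<open>Both sides are extensional, so agreement on the carrier is equality of
      functions.\<close>
    have "compose (carrier (pos (\<L> j))) CP.copair (inj_pos I \<L> j) = fst (f j)"
      using frame_homD(1)[OF dframe_homD(1)[OF f[OF j]]] CP.copair_inj[OF j]
      by (intro extensionalityI[OF compose_extensional]) (auto simp: compose_eq inj_pos_eq)
    moreover have "compose (carrier (neg (\<L> j))) CN.copair (inj_neg I \<L> j) = snd (f j)"
      using frame_homD(1)[OF dframe_homD(2)[OF f[OF j]]] CN.copair_inj[OF j]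
      by (intro extensionalityI[OF compose_extensional]) (auto simp: compose_eq inj_neg_eq)
    ultimately show "dframe_comp (\<L> j) (CP.copair, CN.copair) (dframe_inj I \<L> j) = f j"
      by (simp add: dframe_comp_def dframe_inj_def)
  next
    fix h assume h: "h \<in> dframe_hom (dframe_coprod I \<L>) \<M> \<and>
             (\<forall>j\<in>I. dframe_comp (\<L> j) h (dframe_inj I \<L> j) = f j)"
    then have hh: "fst h \<in> frame_hom ?P (pos \<M>)" "snd h \<in> frame_hom ?N (neg \<M>)"
      using dframe_homD(1,2)[of h "dframe_coprod I \<L>" \<M>] by (simp_all add: dframe_coprod_def)
    have comp: "dframe_comp (\<L> j) h (dframe_inj I \<L> j) = f j" if "j \<in> I" for j
      using h that by blast
    have "fst h (P.coprod_inj j a) = fst (f j) a" if "j \<in> I" "a \<in> carrier (pos (\<L> j))" for j a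
      using that(2) unfolding comp[OF that(1), symmetric]
      by (simp add: dframe_comp_def dframe_inj_def compose_eq inj_pos_eq)
    then have "fst h = CP.copair" using hh(1) by (intro CP.copair_unique) (simp_all add: coprod_pos_def)
    moreover have "snd h (N.coprod_inj j b) = snd (f j) b" if "j \<in> I" "b \<in> carrier (neg (\<L> j))" for j b
      using that(2) unfolding comp[OF that(1), symmetric]
      by (simp add: dframe_comp_def dframe_inj_def compose_eq inj_neg_eq)
    then have "snd h = CN.copair" using hh(2) by (intro CN.copair_unique) (simp_all add: coprod_neg_def)
    ultimately show "h = (CP.copair, CN.copair)" by (simp add: prod_eq_iff)
  qed
qed

theorem theorem26:
  fixes I :: "'i set" and \<L> :: "'i \<Rightarrow> ('a, 'b) dframe"
  assumes "\<And>i. i \<in> I \<Longrightarrow> is_dframe (\<L> i)"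
  shows "is_dframe (dframe_coprod I \<L>) \<and>
    (\<forall>j\<in>I. dframe_inj I \<L> j \<in> dframe_hom (\<L> j) (dframe_coprod I \<L>)) \<and>
    (\<forall>(\<M> :: ('c, 'd) dframe) f.
       is_dframe \<M> \<longrightarrow> (\<forall>j\<in>I. f j \<in> dframe_hom (\<L> j) \<M>) \<longrightarrow>
       (\<exists>!h. h \<in> dframe_hom (dframe_coprod I \<L>) \<M> \<and>
             (\<forall>j\<in>I. dframe_comp (\<L> j) h (dframe_inj I \<L> j) = f j)))"
proof -
  interpret dframe_family I \<L> using assms by (rule dframe_family.intro)
  show ?thesis using is_dframe_coprod dframe_inj_hom copair_ex1 by blast
qed

end
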